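(* Let $N\ge2$, $1<p<\infty$, and $0<s<1$ be such that $sp<N$, and let $p_s^*=\frac{Np}{N-sp}$. Let $W^{s+\log,p}_{rad}(\mathbb{R}^N)$ denote the closed subspace of radially symmetric functions in $W^{s+\log,p}(\mathbb{R}^N)$. Then, for every exponent $q\in(p,p_s^* )$, the continuous embedding $$W^{s+\log,p}_{rad}(\mathbb{R}^N)\hookrightarrow L^q(\mathbb{R}^N)$$ is compact.
   Context: $W^{s+\log,p}(\mathbb{R}^N)$ is the space of real-valued $u\in L^p(\mathbb{R}^N)$ with $[u]_{s+\log,p}<\infty$, where $$[u]^p_{s+\log,p}=\iint_{\mathbb{R}^{2N}}|u(x)-u(y)|^p\,\mathbf{k}^{s+\log,+}_p(x-y)\,dx\,dy,\qquad\mathbf{k}^{s+\log,+}_p(z)=\frac{C(N,s,p)(-\ln|z|)_+}{|z|^{N+sp}},$$ $(a)_+=\max\{0,a\}$, with norm $\|u\|^p_{W^{s+\log,p}(\mathbb{R}^N)}=\|u\|^p_{L^p(\mathbb{R}^N)}+[u]^p_{s+\log,p}$, and $$C(N,s,p)=\begin{cases}\dfrac{s\,p\,2^{2(s-1)}\,\Gamma\left(\frac{N+sp}{2}\right)}{\pi^{\frac{N-1}{2}}\,\Gamma(1-s)\,\Gamma\left(\frac{p+1}{2}\right)}, & s>\tfrac12,\\[8pt]\dfrac{s\,p\,2^{2s-1}\,\Gamma\left(\frac{N+sp}{2}\right)}{\pi^{\frac N2}\,\Gamma(1-s)}, & s\le\tfrac12.\end{cases}$$ *)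

theory Defs
  imports "HOL-Analysis.Analysis"
begin

text \<open>
  Function spaces are represented by sets of functions rather than by sets of classes modulo
  almost-everywhere equality, and their norms by the corresponding seminorms on representatives.
\<close>

definition Lp :: "real \<Rightarrow> (real^'n::finite \<Rightarrow> real) set" where
  "Lp p = {u \<in> borel_measurable lebesgue. integrable lebesgue (\<lambda>x. \<bar>u x\<bar> powr p)}"

definition Lp_norm :: "real \<Rightarrow> (real^'n::finite \<Rightarrow> real) \<Rightarrow> real" where
  "Lp_norm p u = (\<integral>x. \<bar>u x\<bar> powr p \<partial>lebesgue) powr (1 / p)"

definition frac_const :: "nat \<Rightarrow> real \<Rightarrow> real \<Rightarrow> real" where
  "frac_const N s p =
     (if s > 1 / 2
      then s * p * 2 powr (2 * (s - 1)) * Gamma ((real N + s * p) / 2) /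
             (pi powr ((real N - 1) / 2) * Gamma (1 - s) * Gamma ((p + 1) / 2))
      else s * p * 2 powr (2 * s - 1) * Gamma ((real N + s * p) / 2) /
             (pi powr (real N / 2) * Gamma (1 - s)))"

text \<open>At \<open>z = 0\<close> the kernel below takes the value 0 by the library's conventions for division;
  this is immaterial, since the diagonal is a null set.\<close>

definition log_kernel :: "real \<Rightarrow> real \<Rightarrow> real^'n::finite \<Rightarrow> real" where
  "log_kernel s p z =
     frac_const CARD('n) s p * max 0 (- ln (norm z)) / norm z powr (real CARD('n) + s * p)"

text \<open>The \<open>p\<close>-th power of the Gagliardo-type seminorm, possibly infinite.\<close>

definition log_energy :: "real \<Rightarrow> real \<Rightarrow> (real^'n::finite \<Rightarrow> real) \<Rightarrow> ennreal" where
  "log_energy s p u =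
     (\<integral>\<^sup>+(x, y). ennreal (\<bar>u x - u y\<bar> powr p * log_kernel s p (x - y))
        \<partial>(lebesgue :: ((real^'n) \<times> (real^'n)) measure))"

definition W_log :: "real \<Rightarrow> real \<Rightarrow> (real^'n::finite \<Rightarrow> real) set" where
  "W_log s p = {u \<in> Lp p. log_energy s p u < \<infinity>}"

definition W_log_norm :: "real \<Rightarrow> real \<Rightarrow> (real^'n::finite \<Rightarrow> real) \<Rightarrow> real" where
  "W_log_norm s p u = (Lp_norm p u powr p + enn2real (log_energy s p u)) powr (1 / p)"

text \<open>Radial symmetry is a property of the almost-everywhere class of \<open>u\<close>.\<close>

definition radially_symmetric :: "(real^'n::finite \<Rightarrow> real) \<Rightarrow> bool" where
  "radially_symmetric u \<longleftrightarrow> (\<exists>g :: real \<Rightarrow> real. AE x in lebesgue. u x = g (norm x))"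

definition W_log_rad :: "real \<Rightarrow> real \<Rightarrow> (real^'n::finite \<Rightarrow> real) set" where
  "W_log_rad s p = {u \<in> W_log s p. radially_symmetric u}"

definition critical_exponent :: "nat \<Rightarrow> real \<Rightarrow> real \<Rightarrow> real" where
  "critical_exponent N s p = real N * p / (real N - s * p)"

definition continuous_embedding ::
  "('a \<Rightarrow> real) set \<Rightarrow> (('a \<Rightarrow> real) \<Rightarrow> real) \<Rightarrow>
   ('a \<Rightarrow> real) set \<Rightarrow> (('a \<Rightarrow> real) \<Rightarrow> real) \<Rightarrow> bool" where
  "continuous_embedding X normX Y normY \<longleftrightarrow>
     X \<subseteq> Y \<and> (\<exists>C. \<forall>u\<in>X. normY u \<le> C * normX u)"

definition compact_embedding ::
  "('a \<Rightarrow> real) set \<Rightarrow> (('a \<Rightarrow> real) \<Rightarrow> real) \<Rightarrow>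
   ('a \<Rightarrow> real) set \<Rightarrow> (('a \<Rightarrow> real) \<Rightarrow> real) \<Rightarrow> bool" where
  "compact_embedding X normX Y normY \<longleftrightarrow>
     continuous_embedding X normX Y normY \<and>
     (\<forall>u :: nat \<Rightarrow> 'a \<Rightarrow> real.
        (\<forall>k. u k \<in> X) \<and> (\<exists>B. \<forall>k. normX (u k) \<le> B) \<longrightarrow>
        (\<exists>v\<in>Y. \<exists>r :: nat \<Rightarrow> nat. strict_mono r \<and>
           (\<lambda>k. normY (\<lambda>x. u (r k) x - v x)) \<longlonglongrightarrow> 0))"

end

theory Submission
  imports Defs "HOL-Complex_Analysis.Great_Picard"
begin

text \<open>
  Write \<open>N\<close> for the dimension and \<open>E\<^sub>k u\<close> for the function that is constant on every dyadic cube of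
  side \<open>2\<^sup>-\<^sup>k\<close> and equal there to the mean of \<open>u\<close>. Two points of one cube are at distance at most
  \<open>N / 2\<^sup>k\<close>, and for \<open>\<bar>z\<bar> \<le> 1 / e\<close> the logarithmic kernel dominates a multiple of \<open>\<bar>z\<bar>\<close> to the power
  \<open>- N - s p\<close>. Jensen's inequality on each cube therefore gives, for all large \<open>k\<close>,
  \<open>\<parallel>u - E\<^sub>k u\<parallel>\<^sub>p \<le> C 2\<^sup>-\<^sup>k\<^sup>s\<close> with a constant that depends on \<open>u\<close> only through its norm
  (lemma \<open>dyadic_approximation_le_log_energy\<close>). Everything after that uses this decay and a bound
  of the \<open>L\<^sup>p\<close> norm, collected in the predicate \<open>besov_bounded\<close>.

  The decay makes consecutive averages differ by at most a multiple of \<open>\<beta>\<^sup>k\<close> with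
  \<open>\<beta> = 2 powr (N / p - s) > 1\<close>, so \<open>\<bar>E\<^sub>k u\<bar> \<le> c \<beta>\<^sup>k\<close> everywhere. On the layer where \<open>\<bar>u\<bar>\<close> lies between
  \<open>2 c \<beta>\<^sup>k\<close> and \<open>2 c \<beta>\<^sup>k\<^sup>+\<^sup>1\<close> the average is at most half of \<open>\<bar>u\<bar>\<close>, hence \<open>\<bar>u\<bar> \<le> 2 \<bar>u - E\<^sub>k u\<bar>\<close>, and the
  layer contributes to the integral of \<open>\<bar>u\<bar>\<close> to the power \<open>q\<close> at most a constant times the \<open>k\<close>-th
  power of \<open>\<beta> powr (q - p) * 2 powr (- s p)\<close>. This ratio is below 1 exactly when \<open>q\<close> is
  subcritical, and summing the geometric series gives the continuous embedding. The same layer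
  argument at one fixed scale shows more: if \<open>E\<^sub>r u\<close> is uniformly small for a suitable \<open>r\<close>, then \<open>u\<close>
  is small in \<open>L\<^sup>q\<close> (lemma \<open>besov_Lq_small_if_averages_small\<close>); this needs \<open>q > p\<close>, to absorb the
  region where \<open>\<bar>u\<bar>\<close> is small.

  Compactness is thereby reduced to uniform convergence of the averages at each scale. A diagonal
  argument yields a subsequence along which the mean over every dyadic cube converges. Far from
  the origin the means are uniformly small by radial symmetry: the mass of \<open>\<bar>u\<bar>\<^sup>p\<close> in a ball of fixed
  radius is the same for all centres on a sphere about the origin, and a large sphere carries
  many disjoint such balls (lemma \<open>radial_dyadic_average_decay\<close>). Only finitely many cubes remain, so
  the averages are uniformly Cauchy, the subsequence is Cauchy in \<open>L\<^sup>q\<close>, and \<open>L\<^sup>q\<close> is complete.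
\<close>

section \<open>Jensen's inequality for the power function\<close>

lemma powr_above_tangent:
  fixes a b p :: real
  assumes "1 \<le> p" "0 < b" "0 \<le> a"
  shows "b powr p + p * b powr (p - 1) * (a - b) \<le> a powr p"
proof (cases "a = 0")
  case True
  have "b powr p = b powr (p - 1) * b"
    using assms by (simp add: powr_mult_base mult.commute)
  then have "b powr p + p * b powr (p - 1) * (a - b) = (1 - p) * b powr p"
    using True by (simp add: algebra_simps)
  also have "\<dots> \<le> 0"
    using assms by (simp add: mult_nonpos_nonneg)
  finally show ?thesis
    using True by simp
next
  case False
  have "p * b powr (p - 1) * (a - b) \<le> a powr p - b powr p"
  proof (rule convex_on_imp_above_tangent[where A = "{0<..}"])
    show "convex_on {0<..} (\<lambda>x::real. x powr p)"
      using assms by (intro powr_convex)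
    show "((\<lambda>x. x powr p) has_real_derivative p * b powr (p - 1)) (at b within {0<..})"
      using assms by (auto intro!: derivative_eq_intros)
  qed (use assms False in \<open>auto simp: interior_open\<close>)
  then show ?thesis by simp
qed

lemma le_one_plus_powr:
  fixes t p :: real
  assumes "1 \<le> p" "0 \<le> t"
  shows "t \<le> 1 + t powr p"
proof (cases "t \<le> 1")
  case True
  then show ?thesis by (smt (verit) powr_ge_zero)
next
  case False
  then have "t powr 1 \<le> t powr p" using assms by (intro powr_mono) auto
  then show ?thesis using False by simp
qed

text \<open>
  The tangent inequality at the mean value is integrated over \<open>A\<close>. The remaining cases are
  degenerate: if \<open>f\<close> is not integrable its integral is 0, and if its \<open>p\<close>-th power
  is not integrable the right-hand side is infinite.
\<close>

lemma powr_average_le: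
  fixes f :: "'a \<Rightarrow> real"
  assumes p: "1 \<le> p" and c: "0 < c"
    and A: "A \<in> sets M" "emeasure M A = ennreal (1 / c)"
    and f: "f \<in> borel_measurable M"
  shows "ennreal (\<bar>c * (LINT x:A|M. f x)\<bar> powr p)
      \<le> ennreal c * (\<integral>\<^sup>+x\<in>A. ennreal (\<bar>f x\<bar> powr p) \<partial>M)"
proof (cases "(LINT x:A|M. f x) = 0 \<or> (\<integral>\<^sup>+x\<in>A. ennreal (\<bar>f x\<bar> powr p) \<partial>M) = \<infinity>")
  case True
  then show ?thesis using p c by (auto simp: ennreal_mult_top)
next
  case False
  note [measurable] = A(1) f
  define b where "b = \<bar>c * (LINT x:A|M. f x)\<bar>"
  have b: "0 < b" using False c by (simp add: b_def)
  have int_f: "set_integrable M A f"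
    using False unfolding set_integrable_def set_lebesgue_integral_def
    by (metis not_integrable_integral_eq)
  then have int_abs: "set_integrable M A (\<lambda>x. \<bar>f x\<bar>)"
    by (rule set_integrable_abs)
  have eq: "(\<integral>\<^sup>+x\<in>A. ennreal (\<bar>f x\<bar> powr p) \<partial>M) =
      (\<integral>\<^sup>+x. ennreal (indicator A x * \<bar>f x\<bar> powr p) \<partial>M)"
    by (intro nn_integral_cong) (auto split: split_indicator)
  have int_p: "set_integrable M A (\<lambda>x. \<bar>f x\<bar> powr p)"
    unfolding set_integrable_def real_scaleR_def
    by (rule integrableI_nonneg) (use False eq in \<open>auto simp: less_top\<close>)
  have int_1: "set_integrable M A (\<lambda>x. r)" for r :: real
    unfolding set_integrable_def by (rule integrable_scaleR_left) (use A in auto)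
  have int_lin: "set_integrable M A (\<lambda>x. p * b powr (p - 1) * (\<bar>f x\<bar> - b))"
    using set_integral_diff(1)[OF int_abs int_1[of b]] by (rule set_integrable_mult_right)
  have int_const: "(LINT x:A|M. r) = r * (1 / c)" for r :: real
    using A c by (simp add: set_integral_const measure_def)
  have "\<bar>LINT x:A|M. f x\<bar> \<le> (LINT x:A|M. \<bar>f x\<bar>)"
    using set_integral_norm_bound[OF int_f] by simp
  then have "b \<le> c * (LINT x:A|M. \<bar>f x\<bar>)"
    using c by (simp add: b_def abs_mult)
  then have "0 \<le> p * b powr (p - 1) * ((LINT x:A|M. \<bar>f x\<bar>) - b * (1 / c))"
    using p c by (intro mult_nonneg_nonneg) (auto simp: field_simps)
  then have "b powr p * (1 / c)
      \<le> b powr p * (1 / c) + p * b powr (p - 1) * ((LINT x:A|M. \<bar>f x\<bar>) - b * (1 / c))"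
    by simp
  also have "\<dots> = (LINT x:A|M. b powr p + p * b powr (p - 1) * (\<bar>f x\<bar> - b))"
  proof -
    have "(LINT x:A|M. b powr p + p * b powr (p - 1) * (\<bar>f x\<bar> - b))
        = (LINT x:A|M. b powr p) + (LINT x:A|M. p * b powr (p - 1) * (\<bar>f x\<bar> - b))"
      by (rule set_integral_add(2)[OF int_1 int_lin])
    also have "(LINT x:A|M. p * b powr (p - 1) * (\<bar>f x\<bar> - b))
        = p * b powr (p - 1) * (LINT x:A|M. \<bar>f x\<bar> - b)"
      by (rule set_integral_mult_right)
    also have "(LINT x:A|M. \<bar>f x\<bar> - b) = (LINT x:A|M. \<bar>f x\<bar>) - (LINT x:A|M. b)"
      by (rule set_integral_diff(2)[OF int_abs int_1])
    finally show ?thesis by (simp only: int_const)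
  qed
  also have "\<dots> \<le> (LINT x:A|M. \<bar>f x\<bar> powr p)"
    by (rule set_integral_mono[OF set_integral_add(1)[OF int_1 int_lin] int_p])
       (use b p in \<open>auto intro: powr_above_tangent\<close>)
  finally have "b powr p \<le> c * (LINT x:A|M. \<bar>f x\<bar> powr p)"
    using c by (simp add: field_simps)
  moreover have "ennreal (LINT x:A|M. \<bar>f x\<bar> powr p) = (\<integral>\<^sup>+x\<in>A. ennreal (\<bar>f x\<bar> powr p) \<partial>M)"
    unfolding eq set_lebesgue_integral_def
    by (subst nn_integral_eq_integral) (use int_p in \<open>auto simp: set_integrable_def\<close>)
  ultimately show ?thesis
    using c unfolding b_def[symmetric]
    by (metis ennreal_leI ennreal_mult' less_imp_le)
qed

lemma set_integrable_if_powr: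
  fixes u :: "'a \<Rightarrow> real"
  assumes p: "1 \<le> p" and u: "u \<in> borel_measurable M"
    and A: "A \<in> sets M" "emeasure M A < \<infinity>"
    and fin: "(\<integral>\<^sup>+x. ennreal (\<bar>u x\<bar> powr p) \<partial>M) < \<infinity>"
  shows "set_integrable M A u"
proof -
  note [measurable] = A(1) u
  have "integrable M (\<lambda>x. \<bar>u x\<bar> powr p)"
    by (rule integrableI_nonneg) (use fin in auto)
  moreover have "integrable M (\<lambda>x. indicator A x :: real)"
    using A by auto
  ultimately have "integrable M (\<lambda>x. indicator A x + \<bar>u x\<bar> powr p)"
    by simp
  then show ?thesis
    unfolding set_integrable_def
  proof (rule Bochner_Integration.integrable_bound)
    show "AE x in M. norm (indicator A x *\<^sub>R u x) \<le> norm (indicator A x + \<bar>u x\<bar> powr p)"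
      using le_one_plus_powr[OF p] by (auto split: split_indicator)
  qed simp
qed

section \<open>Averages over dyadic cubes\<close>

text \<open>
  The cubes of side \<open>2\<^sup>-\<^sup>k\<close> are indexed by functions to the integers rather than by corner points,
  so that for each \<open>k\<close> they are the fibres of one map with countable range.
\<close>

definition dyadic_index :: "nat \<Rightarrow> real^'n::finite \<Rightarrow> 'n \<Rightarrow> int" where
  "dyadic_index k x = (\<lambda>i. \<lfloor>2 ^ k * x $ i\<rfloor>)"

definition dyadic_cube :: "nat \<Rightarrow> ('n \<Rightarrow> int) \<Rightarrow> (real^'n::finite) set" where
  "dyadic_cube k m = {x. dyadic_index k x = m}"

definition cube_mean :: "nat \<Rightarrow> ('n \<Rightarrow> int) \<Rightarrow> (real^'n::finite \<Rightarrow> real) \<Rightarrow> real" where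
  "cube_mean k m u = 2 ^ (k * CARD('n)) * (LINT x:dyadic_cube k m|lborel. u x)"

definition dyadic_average :: "nat \<Rightarrow> (real^'n::finite \<Rightarrow> real) \<Rightarrow> real^'n \<Rightarrow> real" where
  "dyadic_average k u x = cube_mean k (dyadic_index k x) u"

lemma mem_dyadic_cube: "x \<in> dyadic_cube k m \<longleftrightarrow> dyadic_index k x = m"
  by (simp add: dyadic_cube_def)

lemma floor_scaled_eq_iff:
  "\<lfloor>2 ^ k * (t::real)\<rfloor> = m \<longleftrightarrow> of_int m / 2 ^ k \<le> t \<and> t < (of_int m + 1) / 2 ^ k"
  by (auto simp: floor_eq_iff field_simps)

lemma dyadic_cube_bounds:
  fixes m :: "'n::finite \<Rightarrow> int" and k :: nat
  defines "a \<equiv> (\<chi> i. of_int (m i) / 2 ^ k) :: real^'n"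
    and "b \<equiv> (\<chi> i. (of_int (m i) + 1) / 2 ^ k) :: real^'n"
  shows "box a b \<subseteq> dyadic_cube k m" "dyadic_cube k m \<subseteq> cbox a b"
  by (auto simp: a_def b_def dyadic_cube_def dyadic_index_def mem_box_cart fun_eq_iff
      floor_scaled_eq_iff less_imp_le)

lemma dyadic_cube_borel [measurable]: "dyadic_cube k m \<in> sets borel"
proof -
  have "dyadic_cube k m =
      {x. \<forall>i. of_int (m i) / 2 ^ k \<le> x $ i \<and> x $ i < (of_int (m i) + 1) / 2 ^ k}"
    by (auto simp: dyadic_cube_def dyadic_index_def fun_eq_iff floor_scaled_eq_iff)
  also have "\<dots> \<in> sets borel"
    by measurable
  finally show ?thesis .
qed

text \<open>
  A half-open cube lies between an open and a closed box of the same volume.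
\<close>

lemma emeasure_dyadic_cube:
  "emeasure lborel (dyadic_cube k m :: (real^'n::finite) set) = ennreal (1 / 2 ^ (k * CARD('n)))"
proof -
  define a where "a = ((\<chi> i. of_int (m i) / 2 ^ k) :: real^'n)"
  define b where "b = ((\<chi> i. (of_int (m i) + 1) / 2 ^ k) :: real^'n)"
  have ab: "(b - a) \<bullet> e = 1 / 2 ^ k" if "e \<in> Basis" for e
    using that by (auto simp: Basis_vec_def inner_axis a_def b_def diff_divide_distrib[symmetric])
  then have le: "a \<bullet> e \<le> b \<bullet> e" if "e \<in> Basis" for e
    using that by (smt (verit) inner_diff_left zero_less_divide_1_iff zero_less_power)
  have "(\<Prod>e\<in>Basis. (b - a) \<bullet> e) = (1 / 2 ^ k) ^ CARD('n)"
    by (simp add: ab)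
  also have "\<dots> = 1 / 2 ^ (k * CARD('n))"
    by (simp add: power_one_over power_mult)
  finally have *: "(\<Prod>e\<in>Basis. (b - a) \<bullet> e) = 1 / 2 ^ (k * CARD('n))" .
  have "emeasure lborel (box a b) \<le> emeasure lborel (dyadic_cube k m)"
    "emeasure lborel (dyadic_cube k m) \<le> emeasure lborel (cbox a b)"
    using dyadic_cube_bounds[where k = k and m = m] by (auto intro!: emeasure_mono simp: a_def b_def)
  then show ?thesis
    using le * by (simp add: antisym)
qed

lemma measurable_dyadic_index [measurable]:
  "dyadic_index k \<in> borel \<rightarrow>\<^sub>M count_space (UNIV :: ('n::finite \<Rightarrow> int) set)"
proof -
  have "dyadic_index k -` {m} = dyadic_cube k m" for m :: "'n \<Rightarrow> int"
    by (auto simp: dyadic_cube_def)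
  then show ?thesis
    by (subst measurable_count_space_eq_countable) auto
qed

lemma measurable_dyadic_average [measurable]: "dyadic_average k u \<in> borel_measurable borel"
proof -
  have "(\<lambda>x. cube_mean k (dyadic_index k x) u) \<in> borel_measurable borel"
    by (rule measurable_compose[OF measurable_dyadic_index]) simp
  then show ?thesis
    by (simp add: dyadic_average_def[abs_def])
qed

lemma norm_diff_le_if_same_cube:
  fixes x y :: "real^'n::finite"
  assumes "dyadic_index k x = dyadic_index k y"
  shows "norm (x - y) \<le> real CARD('n) / 2 ^ k"
proof -
  have "\<bar>(x - y) $ i\<bar> \<le> 1 / 2 ^ k" for i
  proof -
    have "\<lfloor>2 ^ k * x $ i\<rfloor> = \<lfloor>2 ^ k * y $ i\<rfloor>"
      using assms by (auto simp: dyadic_index_def dest: fun_cong)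
    then have "\<bar>2 ^ k * x $ i - 2 ^ k * y $ i\<bar> \<le> 1"
      by linarith
    then have "2 ^ k * \<bar>x $ i - y $ i\<bar> \<le> 1"
      by (simp add: right_diff_distrib[symmetric] abs_mult)
    then show ?thesis by (simp add: field_simps)
  qed
  then have "(\<Sum>i\<in>UNIV. \<bar>(x - y) $ i\<bar>) \<le> (\<Sum>i\<in>(UNIV::'n set). 1 / 2 ^ k)"
    by (intro sum_mono)
  then show ?thesis
    using norm_le_l1_cart[of "x - y"] by simp
qed

lemma cube_mean_powr_le:
  fixes u :: "real^'n::finite \<Rightarrow> real"
  assumes "1 \<le> p" "u \<in> borel_measurable borel"
  shows "ennreal (\<bar>cube_mean k m u\<bar> powr p)
    \<le> ennreal (2 ^ (k * CARD('n))) * (\<integral>\<^sup>+x\<in>dyadic_cube k m. ennreal (\<bar>u x\<bar> powr p) \<partial>lborel)"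
  unfolding cube_mean_def
  by (rule powr_average_le) (use assms in \<open>auto simp: emeasure_dyadic_cube\<close>)

lemma set_integrable_dyadic_cube:
  fixes u :: "real^'n::finite \<Rightarrow> real"
  assumes "1 \<le> p" "u \<in> borel_measurable borel"
    and "(\<integral>\<^sup>+x. ennreal (\<bar>u x\<bar> powr p) \<partial>lborel) < \<infinity>"
  shows "set_integrable lborel (dyadic_cube k m) u"
  by (rule set_integrable_if_powr[where p = p]) (use assms in \<open>auto simp: emeasure_dyadic_cube\<close>)

lemma cube_mean_diff:
  assumes "set_integrable lborel (dyadic_cube k m) u" "set_integrable lborel (dyadic_cube k m) v"
  shows "cube_mean k m (\<lambda>x. u x - v x) = cube_mean k m u - cube_mean k m v"
  using assms by (simp add: cube_mean_def set_integral_diff right_diff_distrib)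

lemma cube_mean_const: "cube_mean k m (\<lambda>x. c) = c"
  for m :: "'n::finite \<Rightarrow> int"
proof -
  have "measure lborel (dyadic_cube k m) = 1 / 2 ^ (k * CARD('n))"
    by (simp add: measure_def emeasure_dyadic_cube)
  then show ?thesis
    by (simp add: cube_mean_def set_integral_const emeasure_dyadic_cube)
qed

lemma set_integrable_const_dyadic_cube:
  "set_integrable lborel (dyadic_cube k m) (\<lambda>x. c :: real)"
  unfolding set_integrable_def by (rule integrable_scaleR_left) (auto simp: emeasure_dyadic_cube)

text \<open>
  The difference is the mean of \<open>y \<mapsto> u x - u y\<close> over the cube of \<open>x\<close>, so Jensen's inequality
  bounds it by the increments of \<open>u\<close> inside that cube.
\<close>

lemma diff_dyadic_average_powr_le:
  fixes u :: "real^'n::finite \<Rightarrow> real"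
  assumes "1 \<le> p" "u \<in> borel_measurable borel"
    and "set_integrable lborel (dyadic_cube k (dyadic_index k x)) u"
  shows "ennreal (\<bar>u x - dyadic_average k u x\<bar> powr p) \<le> ennreal (2 ^ (k * CARD('n))) *
    (\<integral>\<^sup>+y\<in>dyadic_cube k (dyadic_index k x). ennreal (\<bar>u x - u y\<bar> powr p) \<partial>lborel)"
proof -
  have "u x - dyadic_average k u x = cube_mean k (dyadic_index k x) (\<lambda>y. u x - u y)"
    using assms by (simp add: dyadic_average_def cube_mean_diff cube_mean_const
        set_integrable_const_dyadic_cube)
  then show ?thesis
    using cube_mean_powr_le[of p "\<lambda>y. u x - u y" k "dyadic_index k x"] assms by simp
qed

lemma dyadic_index_Suc_imp:
  assumes "dyadic_index (Suc k) x = dyadic_index (Suc k) y"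
  shows "dyadic_index k x = dyadic_index k y"
proof -
  have *: "\<lfloor>2 ^ k * (t::real)\<rfloor> = \<lfloor>2 ^ Suc k * t\<rfloor> div 2" for t
    using floor_divide_real_eq_div[of 2 "2 ^ Suc k * t"] by simp
  have "\<lfloor>2 ^ Suc k * x $ i\<rfloor> = \<lfloor>2 ^ Suc k * y $ i\<rfloor>" for i
    using assms by (simp only: dyadic_index_def fun_eq_iff)
  then show ?thesis
    by (simp only: dyadic_index_def *)
qed

text \<open>
  Dyadic cubes are nested, so the coarse average is constant on the fine cube of \<open>x\<close>, and the
  difference of the two averages is the mean of \<open>u - E\<^sub>k u\<close> over that cube. An \<open>L\<^sup>p\<close> bound of the
  approximation error thus becomes a pointwise bound, at the price of the inverse volume of a cube.
\<close>

lemma dyadic_average_Suc_diff_powr_le: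
  fixes u :: "real^'n::finite \<Rightarrow> real"
  assumes p: "1 \<le> p" and u: "u \<in> borel_measurable borel"
    and int: "\<And>m. set_integrable lborel (dyadic_cube (Suc k) m) u"
  shows "ennreal (\<bar>dyadic_average (Suc k) u x - dyadic_average k u x\<bar> powr p)
    \<le> ennreal (2 ^ (Suc k * CARD('n))) *
      (\<integral>\<^sup>+y. ennreal (\<bar>u y - dyadic_average k u y\<bar> powr p) \<partial>lborel)"
proof -
  \<comment> \<open>The fine cube of \<open>x\<close>.\<close>
  define Q where "Q = dyadic_cube (Suc k) (dyadic_index (Suc k) x)"
  have eq: "dyadic_average k u y = dyadic_average k u x" if "y \<in> Q" for y
    using that dyadic_index_Suc_imp[of k y x]
    by (simp add: Q_def mem_dyadic_cube dyadic_average_def)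
  have diff: "dyadic_average (Suc k) u x - dyadic_average k u x
      = cube_mean (Suc k) (dyadic_index (Suc k) x) (\<lambda>y. u y - dyadic_average k u x)"
    by (subst cube_mean_diff[OF int set_integrable_const_dyadic_cube], subst cube_mean_const)
       (simp add: dyadic_average_def)
  have "ennreal (\<bar>dyadic_average (Suc k) u x - dyadic_average k u x\<bar> powr p)
      \<le> ennreal (2 ^ (Suc k * CARD('n))) *
        (\<integral>\<^sup>+y\<in>Q. ennreal (\<bar>u y - dyadic_average k u x\<bar> powr p) \<partial>lborel)"
    unfolding diff Q_def by (rule cube_mean_powr_le) (use p u in auto)
  also have "\<dots> \<le> ennreal (2 ^ (Suc k * CARD('n))) *
      (\<integral>\<^sup>+y. ennreal (\<bar>u y - dyadic_average k u y\<bar> powr p) \<partial>lborel)"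
    by (intro mult_left_mono nn_integral_mono) (auto simp: eq split: split_indicator)
  finally show ?thesis .
qed

section \<open>Approximation by averages and the logarithmic energy\<close>

lemma frac_const_pos:
  assumes "0 < s" "s < 1" "0 < p"
  shows "0 < frac_const N s p"
proof -
  have "0 < (real N + s * p) / 2"
    using assms by (simp add: add_nonneg_pos)
  then have "0 < Gamma ((real N + s * p) / 2)"
    by (rule Gamma_real_pos)
  moreover have "0 < Gamma (1 - s)" "0 < Gamma ((p + 1) / 2)"
    using assms by (auto intro: Gamma_real_pos)
  ultimately show ?thesis
    using assms by (auto simp: frac_const_def intro!: divide_pos_pos mult_pos_pos)
qed

lemma measurable_log_kernel [measurable]: "log_kernel s p \<in> borel_measurable borel"
  unfolding log_kernel_def[abs_def] by measurable

text \<open>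
  For \<open>norm z \<le> exp (- 1)\<close> the logarithmic factor is at least 1, so the kernel is bounded below
  by the fractional kernel, which decreases in \<open>norm z\<close>.
\<close>

lemma log_kernel_lower_bound:
  fixes z :: "real^'n::finite"
  assumes "0 < s" "s < 1" "0 < p" and z: "z \<noteq> 0" "norm z \<le> \<rho>" and \<rho>: "\<rho> \<le> exp (- 1)"
  shows "frac_const CARD('n) s p / \<rho> powr (real CARD('n) + s * p) \<le> log_kernel s p z"
proof -
  have C: "0 < frac_const CARD('n) s p"
    using assms by (intro frac_const_pos)
  have "ln (norm z) \<le> ln (exp (- 1))"
    using z \<rho> by (subst ln_le_cancel_iff) auto
  then have "1 \<le> max 0 (- ln (norm z))"
    by simp
  moreover have "norm z powr (real CARD('n) + s * p) \<le> \<rho> powr (real CARD('n) + s * p)"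
    using assms by (intro powr_mono2) auto
  ultimately show ?thesis
    unfolding log_kernel_def using C z by (intro frac_le) (auto simp: mult_le_cancel_left1)
qed

lemma log_energy_eq_iterated:
  fixes u :: "real^'n::finite \<Rightarrow> real"
  assumes [measurable]: "u \<in> borel_measurable borel"
  shows "log_energy s p u =
    (\<integral>\<^sup>+x. \<integral>\<^sup>+y. ennreal (\<bar>u x - u y\<bar> powr p * log_kernel s p (x - y)) \<partial>lborel \<partial>lborel)"
proof -
  let ?f = "\<lambda>(x, y). ennreal (\<bar>u x - u y\<bar> powr p * log_kernel s p (x - y))"
  have "log_energy s p u = (\<integral>\<^sup>+z. ?f z \<partial>(lborel \<Otimes>\<^sub>M lborel))"
    by (simp add: log_energy_def nn_integral_completion lborel_prod)
  also have "\<dots> = (\<integral>\<^sup>+x. \<integral>\<^sup>+y. ?f (x, y) \<partial>lborel \<partial>lborel)"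
    by (rule lborel.nn_integral_fst[symmetric]) measurable
  finally show ?thesis by simp
qed

text \<open>
  If \<open>u\<close> and \<open>v\<close> agree off a null set \<open>Z\<close>, the integrands agree off the null set of pairs with a
  component in \<open>Z\<close>; this permits the passage to Borel representatives, for which Tonelli's theorem
  on the product of Borel measures is available.
\<close>

lemma log_energy_cong_AE:
  fixes u v :: "real^'n::finite \<Rightarrow> real"
  assumes "AE x in lborel. u x = v x"
  shows "log_energy s p u = log_energy s p v"
proof -
  obtain Z where Z: "Z \<in> null_sets lborel" "{x. u x \<noteq> v x} \<subseteq> Z"
    using assms by (auto elim!: AE_E simp: null_sets_def)
  have [measurable]: "Z \<in> sets borel"
    using Z by auto
  have "AE x in lborel. x \<notin> Z"
    using Z by (rule_tac AE_not_in) auto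
  then have AE_Z: "AE x in lborel. AE y in lborel. x \<notin> Z \<and> y \<notin> Z"
    by eventually_elim (use \<open>AE x in lborel. x \<notin> Z\<close> in auto)
  have "AE w in (lborel \<Otimes>\<^sub>M lborel :: ((real^'n) \<times> (real^'n)) measure). fst w \<notin> Z \<and> snd w \<notin> Z"
    by (rule lborel_pair.AE_pair_measure) (measurable, use AE_Z in auto)
  then have "AE w in (lborel :: ((real^'n) \<times> (real^'n)) measure). fst w \<notin> Z \<and> snd w \<notin> Z"
    by (simp only: lborel_prod)
  then have "AE w in (lebesgue :: ((real^'n) \<times> (real^'n)) measure). fst w \<notin> Z \<and> snd w \<notin> Z"
    by (rule AE_completion)
  then have eq: "AE w in (lebesgue :: ((real^'n) \<times> (real^'n)) measure).
      u (fst w) = v (fst w) \<and> u (snd w) = v (snd w)"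
    by eventually_elim (use Z in auto)
  show ?thesis
    unfolding log_energy_def by (intro nn_integral_cong_AE, rule_tac eventually_mono[OF eq]) auto
qed

text \<open>
  Points \<open>x, y\<close> of one cube satisfy \<open>norm (x - y) \<le> \<rho>\<close> with \<open>\<rho> = N / 2\<^sup>k\<close>, where the kernel is at
  least \<open>C / \<rho> powr (N + s * p)\<close> as soon as \<open>\<rho> \<le> exp (- 1)\<close>. The factor \<open>2\<^sup>k\<^sup>N\<close> from averaging over a
  cube cancels against \<open>\<rho> powr N\<close> up to a constant and leaves the rate \<open>2 powr - (s * p)\<close>.
\<close>

lemma dyadic_approximation_le_log_energy:
  fixes s p :: real
  assumes s: "0 < s" "s < 1" and p: "1 \<le> p"
  obtains K :: real and k0 :: nat where "0 < K"
    and "\<And>(u :: real^'n::finite \<Rightarrow> real) k. u \<in> borel_measurable borel \<Longrightarrow>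
      (\<integral>\<^sup>+x. ennreal (\<bar>u x\<bar> powr p) \<partial>lborel) < \<infinity> \<Longrightarrow> k0 \<le> k \<Longrightarrow>
      (\<integral>\<^sup>+x. ennreal (\<bar>u x - dyadic_average k u x\<bar> powr p) \<partial>lborel)
        \<le> ennreal (K * (2 powr - (s * p)) ^ k) * log_energy s p u"
proof -
  define C where "C = frac_const CARD('n) s p"
  define N where "N = real CARD('n)"
  define K where "K = N powr (N + s * p) / C"
  have C: "0 < C" unfolding C_def using s p by (intro frac_const_pos) auto
  have N: "1 \<le> N" by (simp add: N_def Suc_leI)
  have K: "0 < K" using C N by (simp add: K_def)
  obtain k0 where k0: "N * exp 1 < 2 ^ k0"
    using real_arch_pow[of 2 "N * exp 1"] by auto
  have main: "(\<integral>\<^sup>+x. ennreal (\<bar>u x - dyadic_average k u x\<bar> powr p) \<partial>lborel)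
      \<le> ennreal (K * (2 powr - (s * p)) ^ k) * log_energy s p u"
    if [measurable]: "u \<in> borel_measurable borel"
      and fin: "(\<integral>\<^sup>+x. ennreal (\<bar>u x\<bar> powr p) \<partial>lborel) < \<infinity>" and k: "k0 \<le> k"
    for u :: "real^'n \<Rightarrow> real" and k
  proof -
    define \<rho> where "\<rho> = N / 2 ^ k"
    define c where "c = \<rho> powr (N + s * p) / C"
    have \<rho>: "0 < \<rho>" using N by (simp add: \<rho>_def)
    have c: "0 < c" using C \<rho> by (simp add: c_def)
    have "2 ^ k0 \<le> (2 ^ k :: real)" using k by simp
    then have "N * exp 1 \<le> 2 ^ k" using k0 by linarith
    then have \<rho>_le: "\<rho> \<le> exp (- 1)"
      by (simp add: \<rho>_def exp_minus field_simps)
    have kernel: "\<bar>u x - u y\<bar> powr p \<le> c * (\<bar>u x - u y\<bar> powr p * log_kernel s p (x - y))"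
      if "dyadic_index k x = dyadic_index k y" for x y
    proof (cases "x = y")
      case False
      have "C / \<rho> powr (N + s * p) \<le> log_kernel s p (x - y)"
        unfolding C_def N_def
        by (rule log_kernel_lower_bound)
           (use s p False \<rho>_le norm_diff_le_if_same_cube[OF that] in \<open>auto simp: \<rho>_def N_def\<close>)
      then have "1 \<le> c * log_kernel s p (x - y)"
        using C \<rho> by (simp add: c_def field_simps)
      then have "\<bar>u x - u y\<bar> powr p * 1 \<le> \<bar>u x - u y\<bar> powr p * (c * log_kernel s p (x - y))"
        by (rule mult_left_mono) simp
      then show ?thesis
        by (simp only: mult.left_commute mult_1_right)
    qed simp
    have "(\<integral>\<^sup>+x. ennreal (\<bar>u x - dyadic_average k u x\<bar> powr p) \<partial>lborel)
        \<le> (\<integral>\<^sup>+x. ennreal (2 ^ (k * CARD('n))) * (\<integral>\<^sup>+y\<in>dyadic_cube k (dyadic_index k x).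
              ennreal (\<bar>u x - u y\<bar> powr p) \<partial>lborel) \<partial>lborel)"
      by (intro nn_integral_mono diff_dyadic_average_powr_le set_integrable_dyadic_cube[OF p _ fin])
         (use p in auto)
    also have "\<dots> \<le> (\<integral>\<^sup>+x. ennreal (2 ^ (k * CARD('n))) * (\<integral>\<^sup>+y. ennreal c *
              ennreal (\<bar>u x - u y\<bar> powr p * log_kernel s p (x - y)) \<partial>lborel) \<partial>lborel)"
      using kernel c
      by (intro nn_integral_mono mult_left_mono)
         (auto simp: mem_dyadic_cube ennreal_mult'[symmetric] split: split_indicator intro!: ennreal_leI)
    also have "\<dots> = (\<integral>\<^sup>+x. ennreal (2 ^ (k * CARD('n)) * c) * (\<integral>\<^sup>+y.
              ennreal (\<bar>u x - u y\<bar> powr p * log_kernel s p (x - y)) \<partial>lborel) \<partial>lborel)"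
      using c by (simp add: nn_integral_cmult ennreal_mult mult.assoc)
    also have "\<dots> = ennreal (2 ^ (k * CARD('n)) * c) * log_energy s p u"
      by (simp add: nn_integral_cmult log_energy_eq_iterated)
    also have "2 ^ (k * CARD('n)) * c = K * (2 powr - (s * p)) ^ k"
    proof -
      have "\<rho> powr (N + s * p) = N powr (N + s * p) / (2 ^ k) powr (N + s * p)"
        using N by (simp add: \<rho>_def powr_divide)
      also have "(2 ^ k :: real) powr (N + s * p) = 2 powr (real k * N) * 2 powr (real k * (s * p))"
        by (simp add: powr_realpow[symmetric] powr_powr powr_add[symmetric] algebra_simps)
      also have "2 powr (real k * N) = (2::real) ^ (k * CARD('n))"
        by (simp add: N_def powr_realpow[symmetric])
      finally have 1: "\<rho> powr (N + s * p)
        = N powr (N + s * p) / (2 ^ (k * CARD('n)) * 2 powr (real k * (s * p)))" .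
      have "(2 powr - (s * p)) ^ k = 2 powr (- (real k * (s * p)))"
        by (subst powr_power) auto
      then have 2: "(2 powr - (s * p)) ^ k = 1 / 2 powr (real k * (s * p))"
        by (simp add: powr_minus divide_inverse)
      show ?thesis
        unfolding c_def K_def 1 2 by simp
    qed
    finally show ?thesis .
  qed
  show thesis by (rule that[OF K main])
qed

section \<open>Subcritical integrability from the decay of the approximation error\<close>

text \<open>
  The dyadic counterpart of a ball in the Besov space with smoothness \<open>s\<close> and indices \<open>p\<close> and
  infinity, given by a rate of approximation by step functions: the last clause is \<open>\<parallel>u - E\<^sub>k u\<parallel>\<^sub>p \<le> D powr (1 / p) * 2 powr (- s k)\<close>,
  raised to the power \<open>p\<close>. The clause starts at \<open>k0\<close>, since the logarithmic kernel sees only short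
  distances.
\<close>

definition besov_bounded ::
  "real \<Rightarrow> real \<Rightarrow> nat \<Rightarrow> real \<Rightarrow> real \<Rightarrow> (real^'n::finite \<Rightarrow> real) \<Rightarrow> bool" where
  "besov_bounded p s k0 B D u \<longleftrightarrow> u \<in> borel_measurable borel \<and>
     (\<integral>\<^sup>+x. ennreal (\<bar>u x\<bar> powr p) \<partial>lborel) \<le> ennreal B \<and>
     (\<forall>k\<ge>k0. (\<integral>\<^sup>+x. ennreal (\<bar>u x - dyadic_average k u x\<bar> powr p) \<partial>lborel)
        \<le> ennreal (D * (2 powr - (s * p)) ^ k))"

lemma le_powr_root_if_powr_le:
  fixes t c p :: real
  assumes "0 < p" "0 \<le> t" "t powr p \<le> c"
  shows "t \<le> c powr (1 / p)"
proof -
  have "(t powr p) powr (1 / p) \<le> c powr (1 / p)"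
    using assms by (intro powr_mono2) auto
  then show ?thesis using assms by (simp add: powr_powr)
qed

text \<open>
  Consecutive averages differ by at most \<open>c0 * \<beta> ^ k\<close>. Since \<open>s * p < N\<close> gives \<open>\<beta> > 1\<close>, the sum of
  these increments is, up to a constant, dominated by its last term, so the average at scale \<open>k\<close> grows no faster than
  a single increment.
\<close>

lemma besov_dyadic_average_bound:
  fixes s p B D :: real
  assumes p: "1 \<le> p" and sp: "s * p < real CARD('n::finite)"
    and B: "0 \<le> B" and D: "0 \<le> D"
  obtains c where "0 < c"
    and "\<And>(u :: real^'n \<Rightarrow> real) k x. besov_bounded p s k0 B D u \<Longrightarrow> k0 \<le> k \<Longrightarrow>
      \<bar>dyadic_average k u x\<bar> \<le> c * (2 powr (real CARD('n) / p - s)) ^ k"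
proof -
  define N where "N = real CARD('n)"
  define \<beta> where "\<beta> = 2 powr (N / p - s)"
  define c0 where "c0 = (2 ^ CARD('n) * D) powr (1 / p)"
  define b0 where "b0 = (2 ^ (k0 * CARD('n)) * B) powr (1 / p)"
  \<comment> \<open>\<open>b0\<close> bounds the averages at the first scale; \<open>c0 / (\<beta> - 1)\<close> is what the induction step
    \<open>c + c0 \<le> c * \<beta>\<close> requires.\<close>
  define c where "c = b0 + c0 / (\<beta> - 1) + 1"
  have "0 < N / p - s" using p sp by (simp add: N_def field_simps)
  then have \<beta>: "1 < \<beta>" unfolding \<beta>_def by simp
  have nonneg: "0 \<le> b0" "0 \<le> c0" by (auto simp: b0_def c0_def)
  then have c: "0 < c" "b0 \<le> c" using \<beta> by (auto simp: c_def intro: add_nonneg_pos)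
  have "c0 = (c0 / (\<beta> - 1)) * (\<beta> - 1)" using \<beta> by simp
  also have "\<dots> \<le> c * (\<beta> - 1)"
    using \<beta> nonneg by (intro mult_right_mono) (auto simp: c_def)
  finally have c_step: "c + c0 \<le> c * \<beta>" by (simp add: algebra_simps)
  have bound: "\<bar>dyadic_average k u x\<bar> \<le> c * \<beta> ^ k"
    if u: "besov_bounded p s k0 B D u" and k: "k0 \<le> k" for u :: "real^'n \<Rightarrow> real" and k x
  proof -
    have [measurable]: "u \<in> borel_measurable borel"
      and u_p: "(\<integral>\<^sup>+x. ennreal (\<bar>u x\<bar> powr p) \<partial>lborel) \<le> ennreal B"
      and u_k: "\<And>k. k0 \<le> k \<Longrightarrow>
        (\<integral>\<^sup>+x. ennreal (\<bar>u x - dyadic_average k u x\<bar> powr p) \<partial>lborel)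
          \<le> ennreal (D * (2 powr - (s * p)) ^ k)"
      using u by (auto simp: besov_bounded_def)
    have int: "set_integrable lborel (dyadic_cube k m) u" for k m
      by (rule set_integrable_dyadic_cube[OF p]) (use u_p in \<open>auto simp: order_le_less_trans\<close>)
    show ?thesis
      using k
    proof (induction k rule: dec_induct)
      case base
      have "ennreal (\<bar>dyadic_average k0 u x\<bar> powr p) \<le> ennreal (2 ^ (k0 * CARD('n))) *
          (\<integral>\<^sup>+y\<in>dyadic_cube k0 (dyadic_index k0 x). ennreal (\<bar>u y\<bar> powr p) \<partial>lborel)"
        unfolding dyadic_average_def by (rule cube_mean_powr_le) (use p in auto)
      also have "\<dots> \<le> ennreal (2 ^ (k0 * CARD('n))) * (\<integral>\<^sup>+y. ennreal (\<bar>u y\<bar> powr p) \<partial>lborel)"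
        by (intro mult_left_mono nn_integral_mono) (auto split: split_indicator)
      also have "\<dots> \<le> ennreal (2 ^ (k0 * CARD('n))) * ennreal B"
        using u_p by (intro mult_left_mono) auto
      finally have "\<bar>dyadic_average k0 u x\<bar> powr p \<le> 2 ^ (k0 * CARD('n)) * B"
        using B by (simp add: ennreal_mult[symmetric])
      then have "\<bar>dyadic_average k0 u x\<bar> \<le> b0"
        unfolding b0_def using p by (intro le_powr_root_if_powr_le) auto
      also have "b0 \<le> c * \<beta> ^ k0"
        using c \<beta> one_le_power[of \<beta> k0] mult_left_mono[of 1 "\<beta> ^ k0" c] by linarith
      finally show ?case .
    next
      case (step k)
      have "ennreal (\<bar>dyadic_average (Suc k) u x - dyadic_average k u x\<bar> powr p)
          \<le> ennreal (2 ^ (Suc k * CARD('n))) *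
            (\<integral>\<^sup>+y. ennreal (\<bar>u y - dyadic_average k u y\<bar> powr p) \<partial>lborel)"
        by (rule dyadic_average_Suc_diff_powr_le) (use p int in auto)
      also have "\<dots> \<le> ennreal (2 ^ (Suc k * CARD('n))) * ennreal (D * (2 powr - (s * p)) ^ k)"
        using u_k step by (intro mult_left_mono) auto
      finally have "\<bar>dyadic_average (Suc k) u x - dyadic_average k u x\<bar> powr p
          \<le> 2 ^ (Suc k * CARD('n)) * (D * (2 powr - (s * p)) ^ k)"
        using D by (simp add: ennreal_mult[symmetric])
      also have "\<dots> = (2 ^ CARD('n) * D) * (2 ^ CARD('n) * 2 powr - (s * p)) ^ k"
        by (simp add: power_add power_mult_distrib power_mult[symmetric] mult.commute mult.left_commute)
      also have "2 ^ CARD('n) * 2 powr - (s * p) = \<beta> powr p"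
        using p by (simp add: \<beta>_def N_def powr_powr powr_realpow[symmetric] powr_add[symmetric]
            left_diff_distrib)
      also have "(\<beta> powr p) ^ k = (\<beta> ^ k) powr p"
        using \<beta> by (simp add: powr_realpow[symmetric] powr_powr mult.commute)
      finally have "\<bar>dyadic_average (Suc k) u x - dyadic_average k u x\<bar>
          \<le> (2 ^ CARD('n) * D * (\<beta> ^ k) powr p) powr (1 / p)"
        using p by (intro le_powr_root_if_powr_le) auto
      also have "\<dots> = c0 * \<beta> ^ k"
        using p D \<beta> by (simp add: c0_def powr_mult powr_powr)
      finally have "\<bar>dyadic_average (Suc k) u x\<bar> \<le> c * \<beta> ^ k + c0 * \<beta> ^ k"
        using step.IH by linarith
      also have "\<dots> = (c + c0) * \<beta> ^ k"
        by (simp add: algebra_simps)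
      also have "\<dots> \<le> c * \<beta> * \<beta> ^ k"
        using c_step \<beta> by (intro mult_right_mono) auto
      finally show ?case by simp
    qed
  qed
  show thesis
    by (rule that[OF c(1)]) (use bound in \<open>auto simp: \<beta>_def N_def\<close>)
qed

text \<open>
  If \<open>a\<close> has at most half the size of \<open>t\<close>, then \<open>t\<close> is controlled by the error \<open>t - a\<close>; the upper
  bound \<open>M\<close> pays for the excess of the exponent \<open>q\<close> over \<open>p\<close>.
\<close>

lemma powr_le_if_half_approximated:
  fixes a t L M p q :: real
  assumes "0 < p" "p \<le> q" "0 \<le> L" and t: "L < \<bar>t\<bar>" "\<bar>t\<bar> \<le> M" and a: "\<bar>a\<bar> \<le> L / 2"
  shows "\<bar>t\<bar> powr q \<le> M powr (q - p) * 2 powr p * \<bar>t - a\<bar> powr p"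
proof -
  have "\<bar>t\<bar> \<le> 2 * \<bar>t - a\<bar>"
    using t a by (smt (verit) field_sum_of_halves)
  have "\<bar>t\<bar> powr q = \<bar>t\<bar> powr (q - p) * \<bar>t\<bar> powr p"
    by (simp add: powr_add[symmetric])
  also have "\<dots> \<le> M powr (q - p) * (2 * \<bar>t - a\<bar>) powr p"
    using assms \<open>\<bar>t\<bar> \<le> 2 * \<bar>t - a\<bar>\<close> by (intro mult_mono powr_mono2) auto
  finally show ?thesis
    by (simp add: powr_mult mult.assoc)
qed

lemma ennreal_le_suminf: "f n \<le> (\<Sum>n. f n)" for f :: "nat \<Rightarrow> ennreal"
  using sum_le_suminf[of f "{n}"] by simp

text \<open>
  A pointwise decomposition by the size of \<open>t = u x\<close>, with \<open>a j\<close> in the role of the average at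
  scale \<open>j\<close>. Small values, \<open>\<bar>t\<bar> \<le> \<delta>\<close>, are paid by \<open>\<bar>t\<bar>\<close> to the power \<open>p\<close>; intermediate ones by the error
  at the single scale \<open>r\<close>, whose average is at most \<open>\<delta> / 2\<close>; those with \<open>\<bar>t\<bar>\<close> between \<open>2 * c * \<beta> ^ j\<close> and
  \<open>2 * c * \<beta> ^ Suc j\<close> by the error at scale \<open>j\<close>. The summation index is shifted by \<open>k\<close>, the first
  scale used for large values.
\<close>

lemma powr_le_layer_sum:
  fixes t \<delta> c \<beta> p q :: real and a :: "nat \<Rightarrow> real"
  assumes p: "0 < p" "p \<le> q" and \<beta>: "1 < \<beta>" and c: "0 < c" and \<delta>: "0 < \<delta>"
    and a: "\<And>j. k \<le> j \<Longrightarrow> \<bar>a j\<bar> \<le> c * \<beta> ^ j" and r: "\<bar>a r\<bar> \<le> \<delta> / 2"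
  defines "M \<equiv> \<lambda>j. (2 * c * \<beta> ^ j) powr (q - p) * 2 powr p"
  shows "ennreal (\<bar>t\<bar> powr q) \<le> ennreal (\<delta> powr (q - p) * \<bar>t\<bar> powr p)
    + ennreal (M k * \<bar>t - a r\<bar> powr p)
    + (\<Sum>j. ennreal (M (Suc (k + j)) * \<bar>t - a (k + j)\<bar> powr p))" (is "_ \<le> ?A + ?B + ?S")
proof -
  have summand_le: "x \<le> x + y + z" "y \<le> x + y + z" "z \<le> x + y + z" for x y z :: ennreal
    by (auto intro!: add_increasing add_increasing2)
  consider "\<bar>t\<bar> \<le> \<delta>" | "\<delta> < \<bar>t\<bar>" "\<bar>t\<bar> \<le> 2 * c * \<beta> ^ k" | "2 * c * \<beta> ^ k < \<bar>t\<bar>"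
    by linarith
  then show ?thesis
  proof cases
    case 1
    have "\<bar>t\<bar> powr q = \<bar>t\<bar> powr (q - p) * \<bar>t\<bar> powr p"
      by (simp add: powr_add[symmetric])
    also have "\<dots> \<le> \<delta> powr (q - p) * \<bar>t\<bar> powr p"
      using p 1 by (intro mult_right_mono powr_mono2) auto
    finally have "ennreal (\<bar>t\<bar> powr q) \<le> ?A" by (rule ennreal_leI)
    then show ?thesis using summand_le(1) by (rule order_trans)
  next
    case 2
    have "ennreal (\<bar>t\<bar> powr q) \<le> ?B"
      unfolding M_def
      by (intro ennreal_leI powr_le_if_half_approximated[where L = \<delta>]) (use p \<delta> r 2 in auto)
    then show ?thesis using summand_le(2) by (rule order_trans)
  next
    case 3
    obtain n where n: "\<bar>t\<bar> / (2 * c) < \<beta> ^ n"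
      using real_arch_pow[OF \<beta>] by blast
    have "\<beta> ^ n \<le> \<beta> ^ (k + n)" using \<beta> by (intro power_increasing) auto
    then have "2 * c * \<beta> ^ n \<le> 2 * c * \<beta> ^ (k + n)" using c by simp
    moreover have "\<bar>t\<bar> < 2 * c * \<beta> ^ n" using n c by (simp add: field_simps)
    ultimately have ex: "\<bar>t\<bar> \<le> 2 * c * \<beta> ^ (k + n)" by linarith
    \<comment> \<open>The first threshold that \<open>\<bar>t\<bar>\<close> does not exceed; it is not the initial one, so its predecessor
      is exceeded and \<open>\<bar>t\<bar>\<close> lies in the layer between the two.\<close>
    define m where "m = (LEAST m. \<bar>t\<bar> \<le> 2 * c * \<beta> ^ (k + m))"
    have m: "\<bar>t\<bar> \<le> 2 * c * \<beta> ^ (k + m)"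
      unfolding m_def using ex by (rule LeastI)
    with 3 obtain j where j: "m = Suc j" by (cases m) auto
    have "2 * c * \<beta> ^ (k + j) < \<bar>t\<bar>"
      using not_less_Least[of j "\<lambda>m. \<bar>t\<bar> \<le> 2 * c * \<beta> ^ (k + m)"] j by (simp add: m_def)
    then have "ennreal (\<bar>t\<bar> powr q) \<le> ennreal (M (Suc (k + j)) * \<bar>t - a (k + j)\<bar> powr p)"
      unfolding M_def
      by (intro ennreal_leI powr_le_if_half_approximated[where L = "2 * c * \<beta> ^ (k + j)"])
         (use p c \<beta> m j a[of "k + j"] in auto)
    also have "\<dots> \<le> ?S"
      by (rule ennreal_le_suminf)
    finally show ?thesis using summand_le(3) by (rule order_trans)
  qed
qed

text \<open>
  Integrating the decomposition above, the layers of large values form a geometric series with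
  ratio \<open>\<beta> powr (q - p) * \<sigma> = 2 powr ((N / p - s) * (q - p) - s * p)\<close>, which is less than 1 by the
  subcriticality of \<open>q\<close>. The parameters \<open>\<delta>\<close>, \<open>k\<close> and \<open>r\<close> stay free; a small bound results
  from small \<open>\<delta>\<close>, large \<open>k\<close>, and \<open>r\<close> large in terms of \<open>k\<close>.
\<close>

lemma besov_nn_integral_powr_le:
  fixes s p q B D :: real
  assumes p: "1 \<le> p" and pq: "p \<le> q" and sp: "s * p < real CARD('n::finite)"
    and q: "(real CARD('n) / p - s) * (q - p) < s * p"
    and B: "0 \<le> B" and D: "0 \<le> D"
  defines "\<beta> \<equiv> 2 powr (real CARD('n) / p - s)" and "\<sigma> \<equiv> 2 powr - (s * p)"
  obtains c A where "0 < c" "0 \<le> A"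
    and "\<And>(u :: real^'n \<Rightarrow> real) k r \<delta>. besov_bounded p s k0 B D u \<Longrightarrow> k0 \<le> k \<Longrightarrow> k0 \<le> r \<Longrightarrow>
      0 < \<delta> \<Longrightarrow> (\<And>x. \<bar>dyadic_average r u x\<bar> \<le> \<delta> / 2) \<Longrightarrow>
      (\<integral>\<^sup>+x. ennreal (\<bar>u x\<bar> powr q) \<partial>lborel) \<le> ennreal (\<delta> powr (q - p) * B
        + (2 * c * \<beta> ^ k) powr (q - p) * 2 powr p * (D * \<sigma> ^ r)
        + A * (\<beta> powr (q - p) * \<sigma>) ^ k)"
    and "\<And>(u :: real^'n \<Rightarrow> real) k x. besov_bounded p s k0 B D u \<Longrightarrow> k0 \<le> k \<Longrightarrow>
      \<bar>dyadic_average k u x\<bar> \<le> c * \<beta> ^ k"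
proof -
  obtain c where c: "0 < c"
    and avg: "\<And>(u :: real^'n \<Rightarrow> real) k x. besov_bounded p s k0 B D u \<Longrightarrow> k0 \<le> k \<Longrightarrow>
      \<bar>dyadic_average k u x\<bar> \<le> c * \<beta> ^ k"
    unfolding \<beta>_def by (rule besov_dyadic_average_bound[where ?k0.0 = k0, OF p sp B D]) blast
  define \<gamma> where "\<gamma> = \<beta> powr (q - p) * \<sigma>"
  have "0 < real CARD('n) / p - s" using p sp by (simp add: field_simps)
  then have \<beta>: "1 < \<beta>" unfolding \<beta>_def by simp
  have \<sigma>: "0 < \<sigma>" by (simp add: \<sigma>_def)
  have "\<gamma> = 2 powr ((real CARD('n) / p - s) * (q - p) - s * p)"
    by (simp add: \<gamma>_def \<beta>_def \<sigma>_def powr_powr powr_add[symmetric])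
  also have "\<dots> < 2 powr 0" using q by (intro powr_less_mono) auto
  finally have \<gamma>: "0 < \<gamma>" "\<gamma> < 1" using \<beta> \<sigma> by (simp_all add: \<gamma>_def)
  define M where "M j = (2 * c * \<beta> ^ j) powr (q - p) * 2 powr p" for j
  have M_eq: "M j = (2 * c) powr (q - p) * 2 powr p * (\<beta> powr (q - p)) ^ j" for j
    using \<beta> c by (simp add: M_def powr_mult powr_realpow[symmetric] powr_powr mult_ac)
  define E where "E = (2 * c) powr (q - p) * 2 powr p * \<beta> powr (q - p) * D"
  define A where "A = E / (1 - \<gamma>)"
  have E: "0 \<le> E" using D by (simp add: E_def)
  then have A: "0 \<le> A" using \<gamma> by (simp add: A_def)
  have tail: "M (Suc (k + j)) * (D * \<sigma> ^ (k + j)) = E * \<gamma> ^ k * \<gamma> ^ j" for k j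
    by (simp add: M_eq E_def \<gamma>_def power_mult_distrib power_add mult_ac)
  have main: "(\<integral>\<^sup>+x. ennreal (\<bar>u x\<bar> powr q) \<partial>lborel) \<le> ennreal (\<delta> powr (q - p) * B
        + M k * (D * \<sigma> ^ r) + A * \<gamma> ^ k)"
    if u: "besov_bounded p s k0 B D u" and k: "k0 \<le> k" "k0 \<le> r" and \<delta>: "0 < \<delta>"
      and small: "\<And>x. \<bar>dyadic_average r u x\<bar> \<le> \<delta> / 2"
    for u :: "real^'n \<Rightarrow> real" and k r \<delta>
  proof -
    have [measurable]: "u \<in> borel_measurable borel"
      and u_p: "(\<integral>\<^sup>+x. ennreal (\<bar>u x\<bar> powr p) \<partial>lborel) \<le> ennreal B"
      and u_k: "\<And>k. k0 \<le> k \<Longrightarrow>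
        (\<integral>\<^sup>+x. ennreal (\<bar>u x - dyadic_average k u x\<bar> powr p) \<partial>lborel) \<le> ennreal (D * \<sigma> ^ k)"
      using u by (auto simp: besov_bounded_def \<sigma>_def)
    have M: "0 \<le> M j" for j by (simp add: M_def)
    have "(\<integral>\<^sup>+x. ennreal (\<bar>u x\<bar> powr q) \<partial>lborel)
        \<le> (\<integral>\<^sup>+x. ennreal (\<delta> powr (q - p) * \<bar>u x\<bar> powr p)
          + ennreal (M k * \<bar>u x - dyadic_average r u x\<bar> powr p)
          + (\<Sum>j. ennreal (M (Suc (k + j)) * \<bar>u x - dyadic_average (k + j) u x\<bar> powr p)) \<partial>lborel)"
      unfolding M_def
      by (intro nn_integral_mono powr_le_layer_sum) (use p pq \<beta> c \<delta> k small avg[OF u] in auto)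
    also have "\<dots> = ennreal (\<delta> powr (q - p)) * (\<integral>\<^sup>+x. ennreal (\<bar>u x\<bar> powr p) \<partial>lborel)
        + ennreal (M k) * (\<integral>\<^sup>+x. ennreal (\<bar>u x - dyadic_average r u x\<bar> powr p) \<partial>lborel)
        + (\<Sum>j. ennreal (M (Suc (k + j))) *
            (\<integral>\<^sup>+x. ennreal (\<bar>u x - dyadic_average (k + j) u x\<bar> powr p) \<partial>lborel))"
      using M by (simp add: nn_integral_add nn_integral_suminf ennreal_mult nn_integral_cmult)
    also have "\<dots> \<le> ennreal (\<delta> powr (q - p)) * ennreal B + ennreal (M k) * ennreal (D * \<sigma> ^ r)
        + (\<Sum>j. ennreal (M (Suc (k + j))) * ennreal (D * \<sigma> ^ (k + j)))"
      using u_p u_k k by (intro add_mono mult_left_mono suminf_le) auto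
    also have "(\<Sum>j. ennreal (M (Suc (k + j))) * ennreal (D * \<sigma> ^ (k + j)))
        = (\<Sum>j. ennreal (E * \<gamma> ^ k * \<gamma> ^ j))"
      using M D \<sigma> by (simp add: ennreal_mult[symmetric] tail)
    also have "\<dots> = ennreal (A * \<gamma> ^ k)"
    proof (rule suminf_ennreal_eq)
      have "(\<lambda>j. E * \<gamma> ^ k * \<gamma> ^ j) sums (E * \<gamma> ^ k * (1 / (1 - \<gamma>)))"
        using \<gamma> by (intro sums_mult geometric_sums) auto
      then show "(\<lambda>j. E * \<gamma> ^ k * \<gamma> ^ j) sums (A * \<gamma> ^ k)"
        by (simp add: A_def)
    qed (use E \<gamma> in auto)
    also have "ennreal (\<delta> powr (q - p)) * ennreal B + ennreal (M k) * ennreal (D * \<sigma> ^ r)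
        + ennreal (A * \<gamma> ^ k)
        = ennreal (\<delta> powr (q - p) * B + M k * (D * \<sigma> ^ r) + A * \<gamma> ^ k)"
      using B D M[of k] A \<gamma> \<sigma> by (simp add: ennreal_mult[symmetric] ennreal_plus[symmetric] del: ennreal_plus)
    finally show ?thesis .
  qed
  show thesis
    by (rule that[OF c A main[unfolded M_def \<gamma>_def] avg])
qed

text \<open>
  With \<open>\<delta> = 2 * c * \<beta> ^ k0\<close> the smallness condition on the averages at scale \<open>k0\<close> is the a priori
  bound of those averages.
\<close>

lemma besov_Lq_bound:
  fixes s p q B D :: real
  assumes p: "1 \<le> p" and pq: "p \<le> q" and sp: "s * p < real CARD('n::finite)"
    and q: "(real CARD('n) / p - s) * (q - p) < s * p"
    and B: "0 \<le> B" and D: "0 \<le> D"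
  obtains C where "0 \<le> C"
    and "\<And>u :: real^'n \<Rightarrow> real. besov_bounded p s k0 B D u \<Longrightarrow>
      (\<integral>\<^sup>+x. ennreal (\<bar>u x\<bar> powr q) \<partial>lborel) \<le> ennreal C"
proof -
  define \<beta> where "\<beta> = 2 powr (real CARD('n) / p - s)"
  define \<sigma> where "\<sigma> = 2 powr - (s * p)"
  obtain c A where c: "0 < c" and A: "0 \<le> A"
    and le: "\<And>(u :: real^'n \<Rightarrow> real) k r \<delta>. besov_bounded p s k0 B D u \<Longrightarrow> k0 \<le> k \<Longrightarrow> k0 \<le> r \<Longrightarrow>
      0 < \<delta> \<Longrightarrow> (\<And>x. \<bar>dyadic_average r u x\<bar> \<le> \<delta> / 2) \<Longrightarrow>
      (\<integral>\<^sup>+x. ennreal (\<bar>u x\<bar> powr q) \<partial>lborel) \<le> ennreal (\<delta> powr (q - p) * B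
        + (2 * c * \<beta> ^ k) powr (q - p) * 2 powr p * (D * \<sigma> ^ r)
        + A * (\<beta> powr (q - p) * \<sigma>) ^ k)"
    and avg: "\<And>(u :: real^'n \<Rightarrow> real) k x. besov_bounded p s k0 B D u \<Longrightarrow> k0 \<le> k \<Longrightarrow>
      \<bar>dyadic_average k u x\<bar> \<le> c * \<beta> ^ k"
    unfolding \<beta>_def \<sigma>_def
    by (rule besov_nn_integral_powr_le[where ?k0.0 = k0, OF p pq sp q B D]) blast
  define \<delta> where "\<delta> = 2 * c * \<beta> ^ k0"
  have \<delta>: "0 < \<delta>" using c by (simp add: \<delta>_def \<beta>_def)
  show thesis
  proof (rule that)
    fix u :: "real^'n \<Rightarrow> real" assume u: "besov_bounded p s k0 B D u"
    show "(\<integral>\<^sup>+x. ennreal (\<bar>u x\<bar> powr q) \<partial>lborel) \<le> ennreal (\<delta> powr (q - p) * B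
        + (2 * c * \<beta> ^ k0) powr (q - p) * 2 powr p * (D * \<sigma> ^ k0)
        + A * (\<beta> powr (q - p) * \<sigma>) ^ k0)"
      by (rule le[OF u _ _ \<delta>]) (use avg[OF u] in \<open>auto simp: \<delta>_def\<close>)
  qed (use A B D in \<open>auto simp: \<beta>_def \<sigma>_def\<close>)
qed

text \<open>
  Each of the three terms of the estimate is made at most \<open>\<epsilon> / 3\<close>: the layers of large values by the
  choice of \<open>k\<close>, the intermediate term by \<open>r\<close> once \<open>k\<close> is fixed, and the small values by \<open>\<delta>\<close>, which is
  possible because \<open>q > p\<close>.
\<close>

lemma besov_Lq_small_if_averages_small:
  fixes s p q B D \<epsilon> :: real
  assumes s: "0 < s" and p: "1 \<le> p" and pq: "p < q" and sp: "s * p < real CARD('n::finite)"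
    and q: "(real CARD('n) / p - s) * (q - p) < s * p"
    and B: "0 \<le> B" and D: "0 \<le> D" and \<epsilon>: "0 < \<epsilon>"
  obtains r \<delta> where "0 < \<delta>"
    and "\<And>u :: real^'n \<Rightarrow> real. besov_bounded p s k0 B D u \<Longrightarrow>
      \<forall>x. \<bar>dyadic_average r u x\<bar> \<le> \<delta> \<Longrightarrow>
      (\<integral>\<^sup>+x. ennreal (\<bar>u x\<bar> powr q) \<partial>lborel) \<le> ennreal \<epsilon>"
proof -
  define \<beta> where "\<beta> = 2 powr (real CARD('n) / p - s)"
  define \<sigma> where "\<sigma> = 2 powr - (s * p)"
  define \<gamma> where "\<gamma> = \<beta> powr (q - p) * \<sigma>"
  obtain c A where c: "0 < c" and A: "0 \<le> A"
    and le: "\<And>(u :: real^'n \<Rightarrow> real) k r \<delta>. besov_bounded p s k0 B D u \<Longrightarrow> k0 \<le> k \<Longrightarrow> k0 \<le> r \<Longrightarrow>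
      0 < \<delta> \<Longrightarrow> (\<And>x. \<bar>dyadic_average r u x\<bar> \<le> \<delta> / 2) \<Longrightarrow>
      (\<integral>\<^sup>+x. ennreal (\<bar>u x\<bar> powr q) \<partial>lborel) \<le> ennreal (\<delta> powr (q - p) * B
        + (2 * c * \<beta> ^ k) powr (q - p) * 2 powr p * (D * \<sigma> ^ r) + A * \<gamma> ^ k)"
    unfolding \<gamma>_def \<beta>_def \<sigma>_def
    by (rule besov_nn_integral_powr_le[where ?k0.0 = k0, OF p less_imp_le[OF pq] sp q B D]) blast
  have "\<sigma> < 2 powr 0" unfolding \<sigma>_def using s p by (intro powr_less_mono) auto
  then have \<sigma>: "0 < \<sigma>" "\<sigma> < 1" by (simp_all add: \<sigma>_def)
  have "\<gamma> = 2 powr ((real CARD('n) / p - s) * (q - p) - s * p)"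
    by (simp add: \<gamma>_def \<beta>_def \<sigma>_def powr_powr powr_add[symmetric])
  also have "\<dots> < 2 powr 0" using q by (intro powr_less_mono) auto
  finally have \<gamma>: "0 < \<gamma>" "\<gamma> < 1" using \<sigma> by (simp_all add: \<gamma>_def \<beta>_def)
  have "(\<lambda>k. A * \<gamma> ^ k) \<longlonglongrightarrow> A * 0"
    using \<gamma> by (intro tendsto_mult tendsto_const LIMSEQ_power_zero) auto
  then have "eventually (\<lambda>k. A * \<gamma> ^ k < \<epsilon> / 3) sequentially"
    using \<epsilon> by (intro order_tendstoD) auto
  then obtain k where k: "k0 \<le> k" "A * \<gamma> ^ k < \<epsilon> / 3"
    using eventually_ge_at_top[of k0] by (metis (mono_tags, lifting) eventually_conj eventually_happens'
        trivial_limit_sequentially)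
  define H where "H = (2 * c * \<beta> ^ k) powr (q - p) * 2 powr p"
  have "(\<lambda>r. H * (D * \<sigma> ^ r)) \<longlonglongrightarrow> H * (D * 0)"
    using \<sigma> by (intro tendsto_mult tendsto_const LIMSEQ_power_zero) auto
  then have "eventually (\<lambda>r. H * (D * \<sigma> ^ r) < \<epsilon> / 3) sequentially"
    using \<epsilon> by (intro order_tendstoD) auto
  then obtain r where r: "k0 \<le> r" "H * (D * \<sigma> ^ r) < \<epsilon> / 3"
    using eventually_ge_at_top[of k0] by (metis (mono_tags, lifting) eventually_conj eventually_happens'
        trivial_limit_sequentially)
  define b where "b = B + 1"
  have b: "0 < b" "B \<le> b" using B by (auto simp: b_def)
  define \<delta> where "\<delta> = (\<epsilon> / (3 * b)) powr (1 / (q - p))"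
  have \<delta>: "0 < \<delta>" using \<epsilon> b by (auto simp: \<delta>_def)
  have "\<delta> powr (q - p) = \<epsilon> / (3 * b)"
    using pq \<epsilon> b by (simp add: \<delta>_def powr_powr)
  then have "\<delta> powr (q - p) * B \<le> \<epsilon> / (3 * b) * b"
    using b \<epsilon> by (simp only:) (intro mult_left_mono, auto)
  then have \<delta>_le: "\<delta> powr (q - p) * B \<le> \<epsilon> / 3"
    using b by simp
  show thesis
  proof (rule that[of "\<delta> / 2" r])
    fix u :: "real^'n \<Rightarrow> real"
    assume u: "besov_bounded p s k0 B D u" and small: "\<forall>x. \<bar>dyadic_average r u x\<bar> \<le> \<delta> / 2"
    have "(\<integral>\<^sup>+x. ennreal (\<bar>u x\<bar> powr q) \<partial>lborel)
        \<le> ennreal (\<delta> powr (q - p) * B + H * (D * \<sigma> ^ r) + A * \<gamma> ^ k)"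
      unfolding H_def by (rule le[OF u k(1) r(1) \<delta> small[rule_format]])
    also have "\<dots> \<le> ennreal \<epsilon>"
      using k r \<delta>_le by (intro ennreal_leI) linarith
    finally show "(\<integral>\<^sup>+x. ennreal (\<bar>u x\<bar> powr q) \<partial>lborel) \<le> ennreal \<epsilon>" .
  qed (use \<delta> in simp)
qed

lemma nn_integral_powr_diff_le:
  fixes f g :: "'a \<Rightarrow> real"
  assumes p: "0 < p" and [measurable]: "f \<in> borel_measurable M" "g \<in> borel_measurable M"
    and b: "0 \<le> b" "0 \<le> c"
    and fg: "(\<integral>\<^sup>+x. ennreal (\<bar>f x\<bar> powr p) \<partial>M) \<le> ennreal b"
      "(\<integral>\<^sup>+x. ennreal (\<bar>g x\<bar> powr p) \<partial>M) \<le> ennreal c"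
  shows "(\<integral>\<^sup>+x. ennreal (\<bar>f x - g x\<bar> powr p) \<partial>M) \<le> ennreal (2 powr p * (b + c))"
proof -
  have "(\<integral>\<^sup>+x. ennreal (\<bar>f x - g x\<bar> powr p) \<partial>M)
      \<le> (\<integral>\<^sup>+x. ennreal (2 powr p) * (ennreal (\<bar>f x\<bar> powr p) + ennreal (\<bar>g x\<bar> powr p)) \<partial>M)"
  proof (rule nn_integral_mono)
    fix x
    have "\<bar>f x - g x\<bar> powr p \<le> (2 * max \<bar>f x\<bar> \<bar>g x\<bar>) powr p"
      using p by (intro powr_mono2) auto
    also have "\<dots> \<le> 2 powr p * (\<bar>f x\<bar> powr p + \<bar>g x\<bar> powr p)"
      by (simp add: powr_mult max_def)
    finally show "ennreal (\<bar>f x - g x\<bar> powr p)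
        \<le> ennreal (2 powr p) * (ennreal (\<bar>f x\<bar> powr p) + ennreal (\<bar>g x\<bar> powr p))"
      by (simp add: ennreal_mult'[symmetric] ennreal_plus[symmetric] del: ennreal_plus)
  qed
  also have "\<dots> = ennreal (2 powr p) * ((\<integral>\<^sup>+x. ennreal (\<bar>f x\<bar> powr p) \<partial>M) +
      (\<integral>\<^sup>+x. ennreal (\<bar>g x\<bar> powr p) \<partial>M))"
    by (simp add: nn_integral_cmult nn_integral_add)
  also have "\<dots> \<le> ennreal (2 powr p) * (ennreal b + ennreal c)"
    using fg by (intro mult_left_mono add_mono) auto
  also have "\<dots> = ennreal (2 powr p * (b + c))"
    using b by (simp add: ennreal_mult'[symmetric] ennreal_plus[symmetric] del: ennreal_plus)
  finally show ?thesis .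
qed

lemma besov_bounded_powr_finite:
  assumes "besov_bounded p s k0 B D u"
  shows "(\<integral>\<^sup>+x. ennreal (\<bar>u x\<bar> powr p) \<partial>lborel) < \<infinity>"
  using assms by (auto simp: besov_bounded_def order_le_less_trans)

lemma dyadic_average_diff:
  fixes u v :: "real^'n::finite \<Rightarrow> real"
  assumes p: "1 \<le> p" and u: "besov_bounded p s k0 B D u" and v: "besov_bounded p s k0 B D v"
  shows "dyadic_average k (\<lambda>x. u x - v x) x = dyadic_average k u x - dyadic_average k v x"
  unfolding dyadic_average_def
  by (rule cube_mean_diff; rule set_integrable_dyadic_cube[OF p])
     (use u v besov_bounded_powr_finite in \<open>auto simp: besov_bounded_def order_le_less_trans\<close>)

lemma besov_bounded_diff:
  fixes u v :: "real^'n::finite \<Rightarrow> real"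
  assumes p: "1 \<le> p" and BD: "0 \<le> B" "0 \<le> D"
    and u: "besov_bounded p s k0 B D u" and v: "besov_bounded p s k0 B D v"
  shows "besov_bounded p s k0 (2 powr p * (B + B)) (2 powr p * (D + D)) (\<lambda>x. u x - v x)"
proof -
  have [measurable]: "u \<in> borel_measurable borel" "v \<in> borel_measurable borel"
    using u v by (auto simp: besov_bounded_def)
  have "(\<integral>\<^sup>+x. ennreal (\<bar>(u x - v x) - dyadic_average k (\<lambda>x. u x - v x) x\<bar> powr p) \<partial>lborel)
      \<le> ennreal (2 powr p * (D + D) * (2 powr - (s * p)) ^ k)" if "k0 \<le> k" for k
  proof -
    define \<sigma> where "\<sigma> = (2 powr - (s * p)) ^ k"
    have "(\<integral>\<^sup>+x. ennreal (\<bar>(u x - dyadic_average k u x) - (v x - dyadic_average k v x)\<bar> powr p) \<partial>lborel)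
        \<le> ennreal (2 powr p * (D * \<sigma> + D * \<sigma>))"
      by (rule nn_integral_powr_diff_le)
         (use u v that BD p in \<open>auto simp: besov_bounded_def \<sigma>_def\<close>)
    then show ?thesis
      unfolding dyadic_average_diff[OF p u v] \<sigma>_def[symmetric] by (simp add: algebra_simps)
  qed
  moreover have "(\<integral>\<^sup>+x. ennreal (\<bar>u x - v x\<bar> powr p) \<partial>lborel) \<le> ennreal (2 powr p * (B + B))"
    by (rule nn_integral_powr_diff_le) (use u v BD p in \<open>auto simp: besov_bounded_def\<close>)
  ultimately show ?thesis
    unfolding besov_bounded_def by auto
qed

lemma besov_bounded_scale:
  fixes u :: "real^'n::finite \<Rightarrow> real"
  assumes c: "0 \<le> c" and BD: "0 \<le> B" "0 \<le> D" and u: "besov_bounded p s k0 B D u"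
  shows "besov_bounded p s k0 (c powr p * B) (c powr p * D) (\<lambda>x. c * u x)"
proof -
  have [measurable]: "u \<in> borel_measurable borel"
    using u by (auto simp: besov_bounded_def)
  have *: "(\<integral>\<^sup>+x. ennreal (\<bar>c * f x\<bar> powr p) \<partial>lborel) \<le> ennreal (c powr p * b)"
    if [measurable]: "f \<in> borel_measurable borel" and b: "0 \<le> b"
      "(\<integral>\<^sup>+x. ennreal (\<bar>f x\<bar> powr p) \<partial>lborel) \<le> ennreal b" for f :: "real^'n \<Rightarrow> real" and b
  proof -
    have "(\<integral>\<^sup>+x. ennreal (\<bar>c * f x\<bar> powr p) \<partial>lborel)
        = ennreal (c powr p) * (\<integral>\<^sup>+x. ennreal (\<bar>f x\<bar> powr p) \<partial>lborel)"
      using c by (simp add: abs_mult powr_mult ennreal_mult' nn_integral_cmult)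
    also have "\<dots> \<le> ennreal (c powr p) * ennreal b"
      using b by (intro mult_left_mono) auto
    finally show ?thesis by (simp add: ennreal_mult')
  qed
  have avg: "dyadic_average k (\<lambda>x. c * u x) x = c * dyadic_average k u x" for k x
    by (simp add: dyadic_average_def cube_mean_def)
  have "(\<integral>\<^sup>+x. ennreal (\<bar>c * u x - dyadic_average k (\<lambda>x. c * u x) x\<bar> powr p) \<partial>lborel)
      \<le> ennreal (c powr p * D * (2 powr - (s * p)) ^ k)" if "k0 \<le> k" for k
    using *[of "\<lambda>x. u x - dyadic_average k u x" "D * (2 powr - (s * p)) ^ k"] u BD that
    by (simp add: besov_bounded_def avg right_diff_distrib mult.assoc)
  moreover have "(\<integral>\<^sup>+x. ennreal (\<bar>c * u x\<bar> powr p) \<partial>lborel) \<le> ennreal (c powr p * B)"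
    by (rule *) (use u BD in \<open>auto simp: besov_bounded_def\<close>)
  ultimately show ?thesis
    unfolding besov_bounded_def by auto
qed

section \<open>Decay of averages of radial functions\<close>

text \<open>
  By Vitali's covering theorem an open set is, up to a null set, a countable disjoint union of
  balls, and an orthogonal transformation maps balls to balls of the same radius, hence of the
  same volume.
\<close>

lemma emeasure_le_orthogonal_image:
  fixes T :: "'a::euclidean_space \<Rightarrow> 'a"
  assumes T: "orthogonal_transformation T" and S: "open S"
  shows "emeasure lborel S \<le> emeasure lborel (T ` S)"
proof -
  define K where "K = {(a, r). 0 < r \<and> ball a r \<subseteq> S}"
  have "\<exists>i. i \<in> K \<and> x \<in> ball (fst i) (snd i) \<and> snd i < d" if x: "x \<in> S" and d: "0 < d" for x and d :: real
  proof -
    obtain e where e: "0 < e" "ball x e \<subseteq> S"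
      using S x open_contains_ball by blast
    have "ball x (min e (d / 2)) \<subseteq> S"
      using e by (meson min.cobounded1 order_trans subset_ball)
    then have "(x, min e (d / 2)) \<in> K"
      using e d by (auto simp: K_def)
    then show ?thesis
      using e d by (intro exI[of _ "(x, min e (d / 2))"]) auto
  qed
  from Vitali_covering_theorem_balls[OF this] obtain C where C: "countable C" "C \<subseteq> K"
    and disj: "pairwise (\<lambda>i j. disjnt (ball (fst i) (snd i)) (ball (fst j) (snd j))) C"
    and neg: "negligible (S - (\<Union>i\<in>C. ball (fst i) (snd i)))"
    by blast
  let ?B = "\<lambda>i. ball (fst i) (snd i)" and ?TB = "\<lambda>i. ball (T (fst i)) (snd i)"
  define U where "U = (\<Union>i\<in>C. ?B i)"
  have inj: "inj T" and lin: "linear T"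
    using T by (auto simp: orthogonal_transformation_inj orthogonal_transformation_linear)
  have TU: "T ` U = (\<Union>i\<in>C. ?TB i)"
    using T by (simp add: U_def image_UN image_orthogonal_transformation_ball)
  have [measurable]: "S \<in> sets borel" "U \<in> sets borel"
    using S by (auto simp: U_def intro!: borel_open)
  have US: "U \<subseteq> S"
    unfolding U_def
  proof (rule UN_least)
    fix i assume "i \<in> C"
    then have "i \<in> K" using C by blast
    then show "?B i \<subseteq> S" by (simp add: K_def case_prod_beta)
  qed
  have "S - U \<in> null_sets lborel"
    using neg by (simp add: U_def[symmetric] negligible_iff_null_sets null_sets_completion_iff)
  then have "emeasure lborel S \<le> emeasure lborel U"
  proof -
    assume null: "S - U \<in> null_sets lborel"
    have "emeasure lborel S \<le> emeasure lborel (U \<union> (S - U))"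
      by (intro emeasure_mono) auto
    also have "\<dots> = emeasure lborel U"
      using null by (intro emeasure_Un_null_set) auto
    finally show ?thesis .
  qed
  also have "\<dots> = (\<integral>\<^sup>+i. emeasure lborel (?B i) \<partial>count_space C)"
    unfolding U_def using C disj
    by (intro emeasure_UN_countable) (auto simp: disjoint_family_on_def pairwise_def disjnt_def)
  also have "\<dots> = (\<integral>\<^sup>+i. emeasure lborel (?TB i) \<partial>count_space C)"
    using C by (intro nn_integral_cong) (auto simp: K_def emeasure_ball less_imp_le)
  also have "\<dots> = emeasure lborel (\<Union>i\<in>C. ?TB i)"
  proof (rule emeasure_UN_countable[symmetric])
    show "disjoint_family_on ?TB C"
      unfolding disjoint_family_on_def
    proof (intro ballI impI)
      fix i j assume ij: "i \<in> C" "j \<in> C" "i \<noteq> j"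
      have "?TB i \<inter> ?TB j = T ` ?B i \<inter> T ` ?B j"
        using T by (simp add: image_orthogonal_transformation_ball)
      also have "\<dots> = T ` (?B i \<inter> ?B j)"
        using inj by (simp add: image_Int)
      also have "?B i \<inter> ?B j = {}"
        using disj ij by (auto simp: pairwise_def disjnt_def)
      finally show "?TB i \<inter> ?TB j = {}" by simp
    qed
  qed (use C in auto)
  also have "\<dots> \<le> emeasure lborel (T ` S)"
  proof (rule emeasure_mono)
    show "(\<Union>i\<in>C. ?TB i) \<subseteq> T ` S"
      unfolding TU[symmetric] using US by (rule image_mono)
    have "open (T ` S)"
      using S lin inj orthogonal_transformation_surj[OF T] by (intro open_surjective_linear_image)
    then show "T ` S \<in> sets lborel" by simp
  qed
  finally show ?thesis .
qed

text \<open>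
  The inequality of the previous lemma, applied to the transformation and to its inverse,
  is an equality on open boxes, and these determine the measure.
\<close>

lemma lborel_distr_orthogonal:
  fixes T :: "'a::euclidean_space \<Rightarrow> 'a"
  assumes T: "orthogonal_transformation T"
  shows "distr lborel borel T = lborel"
proof (rule lborel_eqI[symmetric])
  fix l u :: 'a
  assume le: "\<And>b. b \<in> Basis \<Longrightarrow> l \<bullet> b \<le> u \<bullet> b"
  have cont: "continuous_on UNIV T"
    using T by (simp add: linear_continuous_on orthogonal_transformation_linear linear_conv_bounded_linear[symmetric])
  then have [measurable]: "T \<in> borel_measurable borel"
    by (rule borel_measurable_continuous_onI)
  have bij: "bij T" using T by (rule orthogonal_transformation_bij)
  have img: "T ` (T -` box l u) = box l u"
    using bij by (simp add: bij_is_surj surj_image_vimage_eq)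
  have op: "open (T -` box l u)"
    using open_box cont by (rule open_vimage)
  have "emeasure lborel (T -` box l u) \<le> emeasure lborel (box l u)"
    using emeasure_le_orthogonal_image[OF T op] by (simp only: img)
  moreover have "inv T ` box l u = T -` box l u"
    using bij by (simp add: bij_vimage_eq_inv_image)
  then have "emeasure lborel (box l u) \<le> emeasure lborel (T -` box l u)"
    using emeasure_le_orthogonal_image[OF orthogonal_transformation_inv[OF T] open_box[of l u]]
    by (simp only:)
  ultimately have "emeasure lborel (T -` box l u) = emeasure lborel (box l u)"
    by (rule antisym)
  then show "emeasure (distr lborel borel T) (box l u) = (\<Prod>b\<in>Basis. (u - l) \<bullet> b)"
    using le by (simp add: emeasure_distr)
qed simp

text \<open>
  An orthogonal transformation \<open>T\<close> with \<open>T c = c'\<close> maps one ball to the other; it preserves Lebesgue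
  measure, and \<open>u\<close> composed with \<open>T\<close> is almost everywhere \<open>u\<close>.
\<close>

lemma radial_ball_mass_cong:
  fixes u :: "real^'n::finite \<Rightarrow> real"
  assumes [measurable]: "u \<in> borel_measurable borel"
    and radial: "AE x in lborel. u x = g (norm x)" and norm: "norm c = norm c'"
  shows "(\<integral>\<^sup>+x\<in>cball c \<rho>. ennreal (\<bar>u x\<bar> powr p) \<partial>lborel)
    = (\<integral>\<^sup>+x\<in>cball c' \<rho>. ennreal (\<bar>u x\<bar> powr p) \<partial>lborel)"
proof -
  have [measurable]: "cball a r \<in> sets borel" for a :: "real^'n" and r
    by simp
  obtain T where T: "orthogonal_transformation T" and Tc: "T c = c'"
    using orthogonal_transformation_exists[OF norm] by blast
  have lin: "linear T" using T by (rule orthogonal_transformation_linear)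
  have [measurable]: "T \<in> borel_measurable borel"
    using lin by (intro borel_measurable_continuous_onI linear_continuous_on) (simp add: linear_conv_bounded_linear)
  have "AE x in distr lborel borel T. u x = g (norm x)"
    unfolding lborel_distr_orthogonal[OF T] by (rule radial)
  then have "AE x in lborel. u (T x) = g (norm (T x))"
    by (rule AE_distrD[rotated]) simp
  with radial have inv: "AE x in lborel. u (T x) = u x"
    by eventually_elim (simp add: orthogonal_transformation_norm[OF T])
  have ball: "indicator (cball c' \<rho>) (T x) = (indicator (cball c \<rho>) x :: ennreal)" for x
  proof -
    have "dist c' (T x) = dist c x"
      unfolding Tc[symmetric] dist_norm linear_diff[OF lin, symmetric]
      by (rule orthogonal_transformation_norm[OF T])
    then show ?thesis by (simp add: indicator_def)
  qed
  have "(\<integral>\<^sup>+x\<in>cball c' \<rho>. ennreal (\<bar>u x\<bar> powr p) \<partial>lborel)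
      = (\<integral>\<^sup>+x\<in>cball c' \<rho>. ennreal (\<bar>u x\<bar> powr p) \<partial>distr lborel borel T)"
    by (simp add: lborel_distr_orthogonal[OF T])
  also have "\<dots> = (\<integral>\<^sup>+x. ennreal (\<bar>u (T x)\<bar> powr p) * indicator (cball c' \<rho>) (T x) \<partial>lborel)"
    by (rule nn_integral_distr) measurable
  also have "\<dots> = (\<integral>\<^sup>+x\<in>cball c \<rho>. ennreal (\<bar>u x\<bar> powr p) \<partial>lborel)"
    unfolding ball using inv by (intro nn_integral_cong_AE) auto
  finally show ?thesis by simp
qed

text \<open>
  In the plane of two coordinate axes, the points of the sphere with first coordinate
  \<open>3 * \<rho> * l\<close> are more than \<open>2 * \<rho>\<close> apart because their first coordinates are; this is where
  dimension at least 2 enters.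
\<close>

lemma sphere_separated_points:
  fixes \<rho> R :: real and m :: nat
  assumes N: "CARD('n::finite) \<ge> 2" and \<rho>: "0 < \<rho>" and R: "3 * \<rho> * real m \<le> R"
  obtains c :: "nat \<Rightarrow> real^'n" where "\<And>l. l < m \<Longrightarrow> norm (c l) = R"
    and "disjoint_family_on (\<lambda>l. cball (c l) \<rho>) {..<m}"
proof -
  obtain i j :: 'n where ij: "i \<noteq> j"
    using N by (metis (full_types) UNIV_I card_2_iff' card_le_Suc0_iff_eq finite not_less_eq_eq numeral_2_eq_2)
  \<comment> \<open>The second coordinate, which puts the point on the sphere of radius \<open>R\<close>.\<close>
  define h where "h l = sqrt (R\<^sup>2 - (3 * \<rho> * real l)\<^sup>2)" for l
  define c :: "nat \<Rightarrow> real^'n" where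
    "c l = (\<chi> k. if k = i then 3 * \<rho> * real l else if k = j then h l else 0)" for l
  show thesis
  proof (rule that)
    fix l assume l: "l < m"
    have "3 * \<rho> * real l \<le> 3 * \<rho> * real m" using l \<rho> by simp
    then have "3 * \<rho> * real l \<le> R" using R by (rule order_trans)
    moreover have "0 \<le> 3 * \<rho> * real l" using \<rho> by simp
    ultimately have lR: "3 * \<rho> * real l \<le> R" "0 \<le> 3 * \<rho> * real l" by blast+
    then have h: "(h l)\<^sup>2 = R\<^sup>2 - (3 * \<rho> * real l)\<^sup>2"
      by (simp add: h_def power_mono)
    have "(c l $ k)\<^sup>2 = (if k = i then (3 * \<rho> * real l)\<^sup>2 else 0) + (if k = j then (h l)\<^sup>2 else 0)" for k
      using ij by (simp add: c_def)
    then have "(\<Sum>k\<in>UNIV. (c l $ k)\<^sup>2) = (3 * \<rho> * real l)\<^sup>2 + (h l)\<^sup>2"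
      by (simp add: sum.distrib)
    then show "norm (c l) = R"
      using h lR by (simp add: norm_vec_def L2_set_def)
  next
    show "disjoint_family_on (\<lambda>l. cball (c l) \<rho>) {..<m}"
      unfolding disjoint_family_on_def
    proof (intro ballI impI equals0I)
      fix l l' y assume ll: "l \<noteq> l'" and y: "y \<in> cball (c l) \<rho> \<inter> cball (c l') \<rho>"
      have "norm (c l - c l') \<le> 2 * \<rho>"
        using y dist_triangle2[of "c l" "c l'" y] by (simp add: dist_norm[symmetric])
      moreover have "\<bar>(c l - c l') $ i\<bar> \<le> norm (c l - c l')"
        by (rule component_le_norm_cart)
      moreover have "(c l - c l') $ i = 3 * \<rho> * (real l - real l')"
        by (simp add: c_def algebra_simps)
      moreover have "1 \<le> \<bar>real l - real l'\<bar>"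
        using ll by linarith
      then have "3 * \<rho> * 1 \<le> 3 * \<rho> * \<bar>real l - real l'\<bar>"
        using \<rho> by (intro mult_left_mono) auto
      then have "3 * \<rho> \<le> \<bar>3 * \<rho> * (real l - real l')\<bar>"
        using \<rho> by (simp add: abs_mult)
      ultimately show False using \<rho> by linarith
    qed
  qed
qed

lemma radial_ball_mass_le:
  fixes u :: "real^'n::finite \<Rightarrow> real"
  assumes N: "CARD('n) \<ge> 2" and [measurable]: "u \<in> borel_measurable borel"
    and radial: "AE x in lborel. u x = g (norm x)"
    and \<rho>: "0 < \<rho>" and x: "3 * \<rho> * real m \<le> norm x"
  shows "of_nat m * (\<integral>\<^sup>+y\<in>cball x \<rho>. ennreal (\<bar>u y\<bar> powr p) \<partial>lborel)
    \<le> (\<integral>\<^sup>+y. ennreal (\<bar>u y\<bar> powr p) \<partial>lborel)"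
proof -
  have [measurable]: "cball a r \<in> sets borel" for a :: "real^'n" and r
    by simp
  obtain c :: "nat \<Rightarrow> real^'n" where c: "\<And>l. l < m \<Longrightarrow> norm (c l) = norm x"
    and disj: "disjoint_family_on (\<lambda>l. cball (c l) \<rho>) {..<m}"
    using sphere_separated_points[OF N \<rho> x] by blast
  have "of_nat m * (\<integral>\<^sup>+y\<in>cball x \<rho>. ennreal (\<bar>u y\<bar> powr p) \<partial>lborel)
      = (\<Sum>l<m. \<integral>\<^sup>+y\<in>cball x \<rho>. ennreal (\<bar>u y\<bar> powr p) \<partial>lborel)"
    by simp
  also have "\<dots> = (\<Sum>l<m. \<integral>\<^sup>+y\<in>cball (c l) \<rho>. ennreal (\<bar>u y\<bar> powr p) \<partial>lborel)"
    by (intro sum.cong refl radial_ball_mass_cong[OF _ radial]) (auto simp: c)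
  also have "\<dots> = (\<integral>\<^sup>+y. (\<Sum>l<m. ennreal (\<bar>u y\<bar> powr p) * indicator (cball (c l) \<rho>) y) \<partial>lborel)"
    by (rule nn_integral_sum[symmetric]) measurable
  also have "\<dots> \<le> (\<integral>\<^sup>+y. ennreal (\<bar>u y\<bar> powr p) \<partial>lborel)"
  proof (rule nn_integral_mono)
    fix y
    have "(\<Sum>l<m. indicator (cball (c l) \<rho>) y :: ennreal) = indicator (\<Union>l<m. cball (c l) \<rho>) y"
      by (rule indicator_UN_disjoint[symmetric]) (use disj in auto)
    also have "\<dots> \<le> 1" by (simp add: indicator_def)
    finally have "ennreal (\<bar>u y\<bar> powr p) * (\<Sum>l<m. indicator (cball (c l) \<rho>) y)
        \<le> ennreal (\<bar>u y\<bar> powr p) * 1"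
      by (intro mult_left_mono) auto
    then show "(\<Sum>l<m. ennreal (\<bar>u y\<bar> powr p) * indicator (cball (c l) \<rho>) y)
        \<le> ennreal (\<bar>u y\<bar> powr p)"
      by (simp add: sum_distrib_left)
  qed
  finally show ?thesis .
qed

text \<open>
  By the pigeonhole principle: \<open>m\<close> disjoint balls of equal mass share a total mass of at most \<open>B\<close>,
  and the cube of \<open>x\<close> lies in the ball about \<open>x\<close>.
\<close>

lemma radial_dyadic_average_decay:
  fixes u :: "real^'n::finite \<Rightarrow> real"
  assumes N: "CARD('n) \<ge> 2" and p: "1 \<le> p" and u: "u \<in> borel_measurable borel"
    and radial: "AE x in lborel. u x = g (norm x)"
    and B: "0 \<le> B" "(\<integral>\<^sup>+x. ennreal (\<bar>u x\<bar> powr p) \<partial>lborel) \<le> ennreal B"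
    and m: "0 < m" and x: "3 * (real CARD('n) / 2 ^ k) * real m \<le> norm x"
  shows "\<bar>dyadic_average k u x\<bar> powr p \<le> 2 ^ (k * CARD('n)) * B / real m"
proof -
  define \<rho> where "\<rho> = real CARD('n) / 2 ^ k"
  have \<rho>: "0 < \<rho>" by (simp add: \<rho>_def)
  let ?I = "\<integral>\<^sup>+y\<in>cball x \<rho>. ennreal (\<bar>u y\<bar> powr p) \<partial>lborel"
  have "of_nat m * ?I \<le> ennreal B"
    using radial_ball_mass_le[OF N u radial \<rho>, of m x p] x B by (auto simp: \<rho>_def)
  then have "ennreal (1 / real m) * (of_nat m * ?I) \<le> ennreal (1 / real m) * ennreal B"
    by (rule mult_left_mono) simp
  moreover have "ennreal (1 / real m) * of_nat m = 1"
    using m by (simp add: ennreal_of_nat_eq_real_of_nat ennreal_mult'[symmetric])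
  ultimately have I: "?I \<le> ennreal (B / real m)"
    using B m by (simp add: mult.assoc[symmetric] ennreal_mult'[symmetric])
  have "ennreal (\<bar>dyadic_average k u x\<bar> powr p) \<le> ennreal (2 ^ (k * CARD('n))) *
      (\<integral>\<^sup>+y\<in>dyadic_cube k (dyadic_index k x). ennreal (\<bar>u y\<bar> powr p) \<partial>lborel)"
    unfolding dyadic_average_def by (rule cube_mean_powr_le[OF p u])
  also have "\<dots> \<le> ennreal (2 ^ (k * CARD('n))) * ?I"
    using norm_diff_le_if_same_cube[of k x]
    by (intro mult_left_mono nn_integral_mono)
       (auto simp: mem_dyadic_cube \<rho>_def dist_norm split: split_indicator)
  also have "\<dots> \<le> ennreal (2 ^ (k * CARD('n))) * ennreal (B / real m)"
    using I by (intro mult_left_mono) auto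
  finally show ?thesis
    using B by (simp add: ennreal_mult'[symmetric])
qed

section \<open>Selection of a subsequence\<close>

text \<open>
  There are countably many dyadic cubes, and the means over each are bounded along the sequence.
  The diagonal argument asks for one bound for all cubes, so the means are first divided by their
  bounds \<open>b k\<close>.
\<close>

lemma cube_means_convergent_subsequence:
  fixes u :: "nat \<Rightarrow> real^'n::finite \<Rightarrow> real"
  assumes p: "1 \<le> p" and u: "\<And>n. u n \<in> borel_measurable borel" and B: "0 \<le> B"
    and bound: "\<And>n. (\<integral>\<^sup>+x. ennreal (\<bar>u n x\<bar> powr p) \<partial>lborel) \<le> ennreal B"
  obtains r where "strict_mono r" and "\<And>k m. convergent (\<lambda>n. cube_mean k m (u (r n)))"
proof -
  define b where "b k = 1 + 2 ^ (k * CARD('n)) * B" for k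
  have b: "0 < b k" for k using B by (simp add: b_def add_pos_nonneg)
  have mean: "\<bar>cube_mean k m (u n)\<bar> \<le> b k" for k m n
  proof -
    have "ennreal (\<bar>cube_mean k m (u n)\<bar> powr p) \<le> ennreal (2 ^ (k * CARD('n))) *
        (\<integral>\<^sup>+x\<in>dyadic_cube k m. ennreal (\<bar>u n x\<bar> powr p) \<partial>lborel)"
      by (rule cube_mean_powr_le[OF p u])
    also have "\<dots> \<le> ennreal (2 ^ (k * CARD('n))) * (\<integral>\<^sup>+x. ennreal (\<bar>u n x\<bar> powr p) \<partial>lborel)"
      by (intro mult_left_mono nn_integral_mono) (auto split: split_indicator)
    also have "\<dots> \<le> ennreal (2 ^ (k * CARD('n))) * ennreal B"
      using bound by (intro mult_left_mono) auto
    finally have "\<bar>cube_mean k m (u n)\<bar> powr p \<le> 2 ^ (k * CARD('n)) * B"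
      using B by (simp add: ennreal_mult'[symmetric])
    then show ?thesis
      using le_one_plus_powr[OF p, of "\<bar>cube_mean k m (u n)\<bar>"] by (simp add: b_def)
  qed
  have scaled: "norm (cube_mean k m (u n) / b k) \<le> 1" for k m n
    using mean[of k m n] b[of k] by (simp add: abs_of_pos)
  obtain r where r: "strict_mono r"
    and conv: "\<And>z :: nat \<times> ('n \<Rightarrow> int). z \<in> UNIV \<Longrightarrow>
      \<exists>l. (\<lambda>n. cube_mean (fst z) (snd z) (u (r n)) / b (fst z)) \<longlonglongrightarrow> l"
    by (rule function_convergent_subsequence[of "UNIV :: (nat \<times> ('n \<Rightarrow> int)) set"
        "\<lambda>n z. cube_mean (fst z) (snd z) (u n) / b (fst z)" 1]) (use scaled in auto)
  show thesis
  proof (rule that[OF r])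
    fix k m
    obtain l where "(\<lambda>n. cube_mean k m (u (r n)) / b k) \<longlonglongrightarrow> l"
      using conv[of "(k, m)"] by auto
    then have "(\<lambda>n. b k * (cube_mean k m (u (r n)) / b k)) \<longlonglongrightarrow> b k * l"
      by (intro tendsto_mult tendsto_const)
    then show "convergent (\<lambda>n. cube_mean k m (u (r n)))"
      using b[of k] by (auto simp: convergent_def)
  qed
qed

lemma finite_dyadic_index_ball: "finite (dyadic_index k ` ball (0 :: real^'n::finite) R)"
proof (rule finite_subset)
  define a where "a = \<lceil>2 ^ k * R\<rceil> + 1"
  show "dyadic_index k ` ball (0 :: real^'n) R \<subseteq> PiE UNIV (\<lambda>_. {- a..a})"
  proof
    fix m assume "m \<in> dyadic_index k ` ball (0 :: real^'n) R"
    then obtain x :: "real^'n" where x: "norm x < R" and m: "m = dyadic_index k x"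
      by auto
    have "m i \<in> {- a..a}" for i
    proof -
      have "\<bar>x $ i\<bar> \<le> R"
        using component_le_norm_cart[of x i] x by linarith
      then have "\<bar>2 ^ k * x $ i\<bar> \<le> 2 ^ k * R"
        by (simp add: abs_mult)
      then show ?thesis
        unfolding m dyadic_index_def a_def atLeastAtMost_iff by linarith
    qed
    then show "m \<in> PiE UNIV (\<lambda>_. {- a..a})" by auto
  qed
qed (auto intro: finite_PiE)

text \<open>
  Beyond a radius \<open>R\<close> all averages are at most \<open>\<delta> / 2\<close> by radial decay, uniformly in \<open>n\<close>; inside it
  only finitely many cubes matter, and on each the means converge.
\<close>

lemma radial_dyadic_averages_uniformly_Cauchy:
  fixes u :: "nat \<Rightarrow> real^'n::finite \<Rightarrow> real"
  assumes N: "CARD('n) \<ge> 2" and p: "1 \<le> p" and u: "\<And>n. u n \<in> borel_measurable borel"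
    and radial: "\<And>n. AE x in lborel. u n x = g n (norm x)"
    and B: "0 \<le> B" "\<And>n. (\<integral>\<^sup>+x. ennreal (\<bar>u n x\<bar> powr p) \<partial>lborel) \<le> ennreal B"
    and conv: "\<And>m. convergent (\<lambda>n. cube_mean k m (u n))" and \<delta>: "0 < \<delta>"
  obtains M where "\<And>n n' x. M \<le> n \<Longrightarrow> M \<le> n' \<Longrightarrow>
    \<bar>dyadic_average k (u n) x - dyadic_average k (u n') x\<bar> \<le> \<delta>"
proof -
  obtain m :: nat where m: "2 ^ (k * CARD('n)) * B / (\<delta> / 2) powr p < real m"
    using reals_Archimedean2 by blast
  have "0 \<le> 2 ^ (k * CARD('n)) * B / (\<delta> / 2) powr p"
    using B by simp
  then have m0: "0 < m" using m by (cases m) auto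
  have m_le: "2 ^ (k * CARD('n)) * B / real m \<le> (\<delta> / 2) powr p"
    using m m0 \<delta> by (simp add: field_simps)
  define R where "R = 3 * (real CARD('n) / 2 ^ k) * real m"
  have far: "\<bar>dyadic_average k (u n) x\<bar> \<le> \<delta> / 2" if "R \<le> norm x" for n x
  proof -
    have "\<bar>dyadic_average k (u n) x\<bar> powr p \<le> (\<delta> / 2) powr p"
      using radial_dyadic_average_decay[OF N p u radial B m0] that m_le
      by (fastforce simp: R_def intro: order_trans)
    then have "\<bar>dyadic_average k (u n) x\<bar> \<le> ((\<delta> / 2) powr p) powr (1 / p)"
      using p by (intro le_powr_root_if_powr_le) auto
    then show ?thesis using p \<delta> by (simp add: powr_powr)
  qed
  define F where "F = dyadic_index k ` ball (0 :: real^'n) R"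
  have F: "finite F" unfolding F_def by (rule finite_dyadic_index_ball)
  have "\<forall>i\<in>F. \<exists>M. \<forall>n\<ge>M. \<forall>n'\<ge>M. \<bar>cube_mean k i (u n) - cube_mean k i (u n')\<bar> < \<delta>"
  proof
    fix i
    have "Cauchy (\<lambda>n. cube_mean k i (u n))"
      using conv by (rule convergent_Cauchy)
    then show "\<exists>M. \<forall>n\<ge>M. \<forall>n'\<ge>M. \<bar>cube_mean k i (u n) - cube_mean k i (u n')\<bar> < \<delta>"
      using \<delta> by (auto simp: Cauchy_def dist_real_def)
  qed
  then obtain M where M: "\<And>i n n'. i \<in> F \<Longrightarrow> M i \<le> n \<Longrightarrow> M i \<le> n' \<Longrightarrow>
      \<bar>cube_mean k i (u n) - cube_mean k i (u n')\<bar> < \<delta>"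
    by metis
  have M_le: "M i \<le> sum M F" if "i \<in> F" for i
    by (rule member_le_sum) (use F that in auto)
  show thesis
  proof (rule that)
    fix n n' and x :: "real^'n"
    assume n: "sum M F \<le> n" "sum M F \<le> n'"
    show "\<bar>dyadic_average k (u n) x - dyadic_average k (u n') x\<bar> \<le> \<delta>"
    proof (cases "norm x < R")
      case True
      then have i: "dyadic_index k x \<in> F" by (auto simp: F_def)
      show ?thesis
        using M[OF i, of n n'] M_le[OF i] n by (simp add: dyadic_average_def)
    next
      case False
      then show ?thesis using far[of x n] far[of x n'] by linarith
    qed
  qed
qed

section \<open>Completeness of the Lebesgue spaces\<close>

text \<open>
  A subsequence whose increments \<open>d n\<close> satisfy \<open>\<integral> \<bar>d n\<bar> powr q \<le> e n\<close> has, at almost every point,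
  \<open>2 ^ n * \<bar>d n x\<bar>\<close> bounded in \<open>n\<close>, and therefore converges there. Fatou's lemma transfers the Cauchy
  estimates from the subsequence to its limit.
\<close>

lemma Lq_complete:
  fixes f :: "nat \<Rightarrow> 'a \<Rightarrow> real"
  assumes q: "0 < q" and f [measurable]: "\<And>n. f n \<in> borel_measurable M"
    and Cauchy: "\<And>\<epsilon>. 0 < \<epsilon> \<Longrightarrow> \<exists>K. \<forall>m\<ge>K. \<forall>n\<ge>K.
      (\<integral>\<^sup>+x. ennreal (\<bar>f m x - f n x\<bar> powr q) \<partial>M) \<le> ennreal \<epsilon>"
  obtains v where "v \<in> borel_measurable M"
    and "\<And>\<epsilon>. 0 < \<epsilon> \<Longrightarrow> \<exists>K. \<forall>m\<ge>K. (\<integral>\<^sup>+x. ennreal (\<bar>f m x - v x\<bar> powr q) \<partial>M) \<le> ennreal \<epsilon>"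
proof -
  \<comment> \<open>This choice makes the integral of \<open>(2 ^ n * \<bar>d n x\<bar>) powr q\<close> at most \<open>(1 / 2) ^ n\<close>.\<close>
  define e :: "nat \<Rightarrow> real" where "e n = (1 / 2) ^ n / (2 ^ n) powr q" for n
  have e: "0 < e n" for n by (simp add: e_def)
  obtain K where K: "\<And>k m n. K k \<le> m \<Longrightarrow> K k \<le> n \<Longrightarrow>
      (\<integral>\<^sup>+x. ennreal (\<bar>f m x - f n x\<bar> powr q) \<partial>M) \<le> ennreal (e k)"
    using Cauchy[OF e] by metis
  \<comment> \<open>Summing the thresholds makes the subsequence strictly increasing and keeps \<open>K n \<le> r n\<close>.\<close>
  define r where "r n = (\<Sum>k\<le>n. Suc (K k))" for n
  have r: "strict_mono r"
    by (simp add: strict_mono_Suc_iff r_def)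
  have Kr: "K n \<le> r n" for n
    using member_le_sum[of n "{..n}" "\<lambda>k. Suc (K k)"] by (simp add: r_def)
  define d where "d n x = f (r (Suc n)) x - f (r n) x" for n x
  have [measurable]: "d n \<in> borel_measurable M" for n
    by (simp add: d_def[abs_def])
  have "(\<integral>\<^sup>+x. ennreal ((2 ^ n * \<bar>d n x\<bar>) powr q) \<partial>M) \<le> ennreal ((1 / 2) ^ n)" for n
  proof -
    have "(\<integral>\<^sup>+x. ennreal ((2 ^ n * \<bar>d n x\<bar>) powr q) \<partial>M)
        = ennreal ((2 ^ n) powr q) * (\<integral>\<^sup>+x. ennreal (\<bar>d n x\<bar> powr q) \<partial>M)"
      by (simp add: powr_mult ennreal_mult nn_integral_cmult)
    also have "\<dots> \<le> ennreal ((2 ^ n) powr q) * ennreal (e n)"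
      unfolding d_def using Kr[of n] strict_mono_less_eq[OF r, of n "Suc n"]
      by (intro mult_left_mono K) auto
    also have "\<dots> = ennreal ((1 / 2) ^ n)"
      by (simp add: ennreal_mult'[symmetric] e_def)
    finally show ?thesis .
  qed
  then have "(\<integral>\<^sup>+x. (\<Sum>n. ennreal ((2 ^ n * \<bar>d n x\<bar>) powr q)) \<partial>M) \<le> (\<Sum>n. ennreal ((1 / 2) ^ n))"
    by (subst nn_integral_suminf) (auto intro!: suminf_le)
  also have "(\<Sum>n. ennreal ((1 / 2) ^ n)) = ennreal 2"
    by (rule suminf_ennreal_eq) (use geometric_sums[of "1 / 2 :: real"] in auto)
  finally have "(\<integral>\<^sup>+x. (\<Sum>n. ennreal ((2 ^ n * \<bar>d n x\<bar>) powr q)) \<partial>M) \<noteq> \<infinity>"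
    by (auto simp: top_unique)
  then have "AE x in M. (\<Sum>n. ennreal ((2 ^ n * \<bar>d n x\<bar>) powr q)) \<noteq> \<infinity>"
    by (intro nn_integral_noteq_infinite) auto
  then have AE_conv: "AE x in M. convergent (\<lambda>n. f (r n) x)"
  proof eventually_elim
    fix x assume fin: "(\<Sum>n. ennreal ((2 ^ n * \<bar>d n x\<bar>) powr q)) \<noteq> \<infinity>"
    define Z where "Z = (\<Sum>n. ennreal ((2 ^ n * \<bar>d n x\<bar>) powr q))"
    obtain S where S: "0 \<le> S" "Z = ennreal S"
      using fin unfolding Z_def[symmetric] by (cases Z rule: ennreal_cases) auto
    have d_le: "norm (d n x) \<le> S powr (1 / q) * (1 / 2) ^ n" for n
    proof -
      have "ennreal ((2 ^ n * \<bar>d n x\<bar>) powr q) \<le> ennreal S"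
        unfolding S(2)[symmetric] Z_def by (rule ennreal_le_suminf)
      then have "(2 ^ n * \<bar>d n x\<bar>) powr q \<le> S"
        using S(1) by (simp only: ennreal_le_iff)
      then have "2 ^ n * \<bar>d n x\<bar> \<le> S powr (1 / q)"
        by (rule le_powr_root_if_powr_le[OF q, rotated]) simp
      then have "2 ^ n * \<bar>d n x\<bar> * (1 / 2) ^ n \<le> S powr (1 / q) * (1 / 2) ^ n"
        by (rule mult_right_mono) simp
      then show ?thesis by (simp add: power_one_over)
    qed
    have "summable (\<lambda>n. S powr (1 / q) * (1 / 2) ^ n)"
      by (intro summable_mult summable_geometric) auto
    then have "summable (\<lambda>n. d n x)"
      by (rule summable_comparison_test'[where N = 0]) (use d_le in auto)
    then have "convergent (\<lambda>n. \<Sum>i<n. d i x)"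
      by (simp add: summable_iff_convergent)
    moreover have "(\<Sum>i<n. d i x) = f (r n) x - f (r 0) x" for n
      unfolding d_def by (rule sum_lessThan_telescope)
    ultimately have "convergent (\<lambda>n. f (r n) x - f (r 0) x)"
      by simp
    then show "convergent (\<lambda>n. f (r n) x)"
      using convergent_add[OF _ convergent_const[of "f (r 0) x"]] by fastforce
  qed
  define v where "v x = lim (\<lambda>n. f (r n) x)" for x
  have v [measurable]: "v \<in> borel_measurable M"
    unfolding v_def[abs_def] by measurable
  show thesis
  proof (rule that[OF v])
    fix \<epsilon> :: real assume "0 < \<epsilon>"
    then obtain L where L: "\<And>m n. L \<le> m \<Longrightarrow> L \<le> n \<Longrightarrow>
        (\<integral>\<^sup>+x. ennreal (\<bar>f m x - f n x\<bar> powr q) \<partial>M) \<le> ennreal \<epsilon>"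
      using Cauchy by blast
    have "(\<integral>\<^sup>+x. ennreal (\<bar>f m x - v x\<bar> powr q) \<partial>M) \<le> ennreal \<epsilon>" if m: "L \<le> m" for m
    proof -
      have "(\<integral>\<^sup>+x. ennreal (\<bar>f m x - v x\<bar> powr q) \<partial>M)
          = (\<integral>\<^sup>+x. liminf (\<lambda>n. ennreal (\<bar>f m x - f (r n) x\<bar> powr q)) \<partial>M)"
      proof (rule nn_integral_cong_AE)
        show "AE x in M. ennreal (\<bar>f m x - v x\<bar> powr q)
            = liminf (\<lambda>n. ennreal (\<bar>f m x - f (r n) x\<bar> powr q))"
          using AE_conv
        proof eventually_elim
          fix x assume "convergent (\<lambda>n. f (r n) x)"
          then have "(\<lambda>n. f (r n) x) \<longlonglongrightarrow> v x"
            by (simp add: v_def convergent_LIMSEQ_iff)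
          then have "(\<lambda>n. ennreal (\<bar>f m x - f (r n) x\<bar> powr q)) \<longlonglongrightarrow> ennreal (\<bar>f m x - v x\<bar> powr q)"
            using q by (intro tendsto_ennrealI tendsto_powr2 tendsto_intros) auto
          then show "ennreal (\<bar>f m x - v x\<bar> powr q)
            = liminf (\<lambda>n. ennreal (\<bar>f m x - f (r n) x\<bar> powr q))"
            by (intro lim_imp_Liminf[symmetric]) auto
        qed
      qed
      also have "\<dots> \<le> liminf (\<lambda>n. \<integral>\<^sup>+x. ennreal (\<bar>f m x - f (r n) x\<bar> powr q) \<partial>M)"
        by (rule nn_integral_liminf) measurable
      also have "\<dots> \<le> limsup (\<lambda>n. \<integral>\<^sup>+x. ennreal (\<bar>f m x - f (r n) x\<bar> powr q) \<partial>M)"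
        by (rule Liminf_le_Limsup) simp
      also have "\<dots> \<le> ennreal \<epsilon>"
      proof (rule Limsup_bounded)
        show "eventually (\<lambda>n. (\<integral>\<^sup>+x. ennreal (\<bar>f m x - f (r n) x\<bar> powr q) \<partial>M) \<le> ennreal \<epsilon>) sequentially"
          using eventually_ge_at_top[of L]
          by eventually_elim (intro L m, meson order_trans seq_suble r)
      qed
      finally show ?thesis .
    qed
    then show "\<exists>K. \<forall>m\<ge>K. (\<integral>\<^sup>+x. ennreal (\<bar>f m x - v x\<bar> powr q) \<partial>M) \<le> ennreal \<epsilon>"
      by blast
  qed
qed

section \<open>Borel representatives and the continuous embedding\<close>

lemma Lp_if_nn_integral_le:
  fixes u u' :: "real^'n::finite \<Rightarrow> real"
  assumes q: "0 < q" and u: "u \<in> borel_measurable lebesgue"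
    and eq: "AE x in lborel. u x = u' x" and C: "0 \<le> C"
    and le: "(\<integral>\<^sup>+x. ennreal (\<bar>u' x\<bar> powr q) \<partial>lborel) \<le> ennreal C"
  shows "u \<in> Lp q" "Lp_norm q u \<le> C powr (1 / q)"
proof -
  note [measurable] = u
  have "AE x in lebesgue. u x = u' x"
    using eq by (rule AE_completion)
  then have "(\<integral>\<^sup>+x. ennreal (\<bar>u x\<bar> powr q) \<partial>lebesgue) = (\<integral>\<^sup>+x. ennreal (\<bar>u' x\<bar> powr q) \<partial>lebesgue)"
    by (intro nn_integral_cong_AE) (auto elim: eventually_mono)
  then have le': "(\<integral>\<^sup>+x. ennreal (\<bar>u x\<bar> powr q) \<partial>lebesgue) \<le> ennreal C"
    using le by (simp add: nn_integral_completion)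
  have int: "integrable lebesgue (\<lambda>x. \<bar>u x\<bar> powr q)"
    by (rule integrableI_nonneg) (use le' in \<open>auto simp: order_le_less_trans\<close>)
  then show "u \<in> Lp q"
    using u by (simp add: Lp_def)
  have "ennreal (\<integral>x. \<bar>u x\<bar> powr q \<partial>lebesgue) \<le> ennreal C"
    using le' by (subst nn_integral_eq_integral[OF int, symmetric]) auto
  then show "Lp_norm q u \<le> C powr (1 / q)"
    unfolding Lp_norm_def using q C by (intro powr_mono2) auto
qed

text \<open>
  An element of the space with norm at most \<open>b\<close> has a Borel representative of the same energy
  and \<open>L\<^sup>p\<close> norm, whose bounds are those of the norm raised to the power \<open>p\<close>. The last hypothesis is
  the conclusion of \<open>dyadic_approximation_le_log_energy\<close>, with its constants \<open>K\<close> and \<open>k0\<close> fixed.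
\<close>

lemma besov_bounded_representative:
  fixes u :: "real^'n::finite \<Rightarrow> real"
  assumes p: "1 \<le> p" and u: "u \<in> W_log s p" and b: "W_log_norm s p u \<le> b" and K: "0 < K"
    and approx: "\<And>(u :: real^'n \<Rightarrow> real) k. u \<in> borel_measurable borel \<Longrightarrow>
      (\<integral>\<^sup>+x. ennreal (\<bar>u x\<bar> powr p) \<partial>lborel) < \<infinity> \<Longrightarrow> k0 \<le> k \<Longrightarrow>
      (\<integral>\<^sup>+x. ennreal (\<bar>u x - dyadic_average k u x\<bar> powr p) \<partial>lborel)
        \<le> ennreal (K * (2 powr - (s * p)) ^ k) * log_energy s p u"
  obtains u' where "AE x in lborel. u x = u' x"
    and "besov_bounded p s k0 (b powr p) (K * b powr p) u'"
proof -
  have meas: "u \<in> borel_measurable lebesgue" and int: "integrable lebesgue (\<lambda>x. \<bar>u x\<bar> powr p)"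
    and fin: "log_energy s p u < \<infinity>"
    using u by (auto simp: W_log_def Lp_def)
  obtain u' where u' [measurable]: "u' \<in> borel_measurable borel" and eq: "AE x in lborel. u x = u' x"
    using completion_ex_borel_measurable_real[OF meas] by auto
  define X where "X = (\<integral>x. \<bar>u x\<bar> powr p \<partial>lebesgue)"
  define E where "E = enn2real (log_energy s p u)"
  have X: "0 \<le> X" and E: "0 \<le> E" by (auto simp: X_def E_def)
  have "W_log_norm s p u = (X + E) powr (1 / p)"
    using p X by (simp add: W_log_norm_def Lp_norm_def X_def[symmetric] E_def[symmetric] powr_powr)
  then have "((X + E) powr (1 / p)) powr p \<le> b powr p"
    using b p by (intro powr_mono2) auto
  then have XE: "X + E \<le> b powr p"
    using p X E by (simp add: powr_powr)
  have energy: "log_energy s p u' = ennreal E"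
    using fin by (simp add: E_def log_energy_cong_AE[OF eq])
  have "AE x in lebesgue. u x = u' x"
    using eq by (rule AE_completion)
  then have "(\<integral>\<^sup>+x. ennreal (\<bar>u x\<bar> powr p) \<partial>lebesgue) = (\<integral>\<^sup>+x. ennreal (\<bar>u' x\<bar> powr p) \<partial>lebesgue)"
    by (intro nn_integral_cong_AE) (auto elim: eventually_mono)
  then have mass: "(\<integral>\<^sup>+x. ennreal (\<bar>u' x\<bar> powr p) \<partial>lborel) = ennreal X"
    unfolding X_def by (simp add: nn_integral_completion nn_integral_eq_integral[OF int, symmetric])
  have "(\<integral>\<^sup>+x. ennreal (\<bar>u' x - dyadic_average k u' x\<bar> powr p) \<partial>lborel)
      \<le> ennreal (K * b powr p * (2 powr - (s * p)) ^ k)" if "k0 \<le> k" for k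
  proof -
    have "(\<integral>\<^sup>+x. ennreal (\<bar>u' x - dyadic_average k u' x\<bar> powr p) \<partial>lborel)
        \<le> ennreal (K * (2 powr - (s * p)) ^ k) * ennreal E"
      using approx[OF u' _ that] by (simp add: mass energy)
    also have "\<dots> = ennreal (K * (2 powr - (s * p)) ^ k * E)"
      using K by (simp add: ennreal_mult')
    also have "\<dots> \<le> ennreal (K * (2 powr - (s * p)) ^ k * b powr p)"
      using XE X K by (intro ennreal_leI mult_left_mono) auto
    finally show ?thesis by (simp only: mult_ac)
  qed
  then have "besov_bounded p s k0 (b powr p) (K * b powr p) u'"
    using XE E by (auto simp: besov_bounded_def mass intro!: ennreal_leI)
  with eq show thesis by (rule that)
qed

text \<open>
  The bound for \<open>besov_bounded\<close> functions with constants 1 and \<open>K\<close> is applied to \<open>u / b\<close> for every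
  positive \<open>b\<close> above the norm of \<open>u\<close>, and homogeneity gives the linear estimate with \<open>b\<close> in place of
  the norm. Letting \<open>b\<close> tend to the norm covers functions of norm 0 as well.
\<close>

lemma W_log_continuous_embedding_Lq:
  fixes s p q :: real
  assumes s: "0 < s" "s < 1" and p: "1 \<le> p" and pq: "p \<le> q" and sp: "s * p < real CARD('n::finite)"
    and q: "(real CARD('n) / p - s) * (q - p) < s * p"
  shows "continuous_embedding (W_log s p :: (real^'n \<Rightarrow> real) set) (W_log_norm s p) (Lp q) (Lp_norm q)"
proof -
  obtain K :: real and k0 :: nat where K: "0 < K"
    and approx: "\<And>(u :: real^'n \<Rightarrow> real) k. u \<in> borel_measurable borel \<Longrightarrow>
      (\<integral>\<^sup>+x. ennreal (\<bar>u x\<bar> powr p) \<partial>lborel) < \<infinity> \<Longrightarrow> k0 \<le> k \<Longrightarrow>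
      (\<integral>\<^sup>+x. ennreal (\<bar>u x - dyadic_average k u x\<bar> powr p) \<partial>lborel)
        \<le> ennreal (K * (2 powr - (s * p)) ^ k) * log_energy s p u"
    by (rule dyadic_approximation_le_log_energy[OF s p]) blast
  obtain C where C: "0 \<le> C" and bound: "\<And>u :: real^'n \<Rightarrow> real. besov_bounded p s k0 1 K u \<Longrightarrow>
      (\<integral>\<^sup>+x. ennreal (\<bar>u x\<bar> powr q) \<partial>lborel) \<le> ennreal C"
    by (rule besov_Lq_bound[where ?k0.0 = k0 and B = 1 and D = K, OF p pq sp q]) (use K in auto)
  define C1 where "C1 = C powr (1 / q)"
  have C1: "0 \<le> C1" by (simp add: C1_def)
  have q0: "0 < q" using p pq by simp
  have *: "u \<in> Lp q \<and> Lp_norm q u \<le> b * C1"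
    if u: "u \<in> W_log s p" and b: "W_log_norm s p u \<le> b" "0 < b" for u :: "real^'n \<Rightarrow> real" and b
  proof -
    obtain u' where eq: "AE x in lborel. u x = u' x"
      and u': "besov_bounded p s k0 (b powr p) (K * b powr p) u'"
      using besov_bounded_representative[OF p u b(1) K approx] by blast
    have [measurable]: "u' \<in> borel_measurable borel"
      using u' by (simp add: besov_bounded_def)
    have "besov_bounded p s k0 ((1 / b) powr p * b powr p) ((1 / b) powr p * (K * b powr p))
        (\<lambda>x. (1 / b) * u' x)"
      using b K by (intro besov_bounded_scale u') auto
    moreover have "(1 / b) powr p * b powr p = 1"
      using b by (simp add: powr_mult[symmetric])
    ultimately have "besov_bounded p s k0 1 K (\<lambda>x. (1 / b) * u' x)"
      by (metis mult.left_commute mult.right_neutral)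
    then have le: "(\<integral>\<^sup>+x. ennreal (\<bar>(1 / b) * u' x\<bar> powr q) \<partial>lborel) \<le> ennreal C"
      by (rule bound)
    have "(\<integral>\<^sup>+x. ennreal (\<bar>u' x\<bar> powr q) \<partial>lborel)
        = (\<integral>\<^sup>+x. ennreal (b powr q) * ennreal (\<bar>(1 / b) * u' x\<bar> powr q) \<partial>lborel)"
      using b by (intro nn_integral_cong)
        (simp add: ennreal_mult'[symmetric] powr_mult[symmetric] abs_mult)
    also have "\<dots> = ennreal (b powr q) * (\<integral>\<^sup>+x. ennreal (\<bar>(1 / b) * u' x\<bar> powr q) \<partial>lborel)"
      by (rule nn_integral_cmult) measurable
    also have "\<dots> \<le> ennreal (b powr q) * ennreal C"
      using le by (intro mult_left_mono) auto
    finally have "(\<integral>\<^sup>+x. ennreal (\<bar>u' x\<bar> powr q) \<partial>lborel) \<le> ennreal (b powr q * C)"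
      by (simp add: ennreal_mult')
    from Lp_if_nn_integral_le[OF q0 _ eq _ this] have "u \<in> Lp q" "Lp_norm q u \<le> (b powr q * C) powr (1 / q)"
      using u C by (auto simp: W_log_def Lp_def)
    moreover have "(b powr q * C) powr (1 / q) = b * C1"
      using q0 b C by (simp add: powr_mult powr_powr C1_def)
    ultimately show ?thesis by simp
  qed
  have "u \<in> Lp q \<and> Lp_norm q u \<le> C1 * W_log_norm s p u" if u: "u \<in> W_log s p" for u :: "real^'n \<Rightarrow> real"
  proof
    have n: "0 \<le> W_log_norm s p u" by (simp add: W_log_norm_def)
    then show "u \<in> Lp q" using *[OF u, of "W_log_norm s p u + 1"] by simp
    show "Lp_norm q u \<le> C1 * W_log_norm s p u"
    proof (rule field_le_epsilon)
      fix e :: real assume e: "0 < e"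
      define b where "b = W_log_norm s p u + e / (C1 + 1)"
      have "0 < e / (C1 + 1)" using e C1 by simp
      then have "Lp_norm q u \<le> b * C1"
        using *[OF u, of b] n by (simp add: b_def)
      also have "\<dots> = C1 * W_log_norm s p u + e * (C1 / (C1 + 1))"
        by (simp add: b_def algebra_simps)
      also have "e * (C1 / (C1 + 1)) \<le> e * 1"
        using e C1 by (intro mult_left_mono) auto
      finally show "Lp_norm q u \<le> C1 * W_log_norm s p u + e" by simp
    qed
  qed
  then show ?thesis
    unfolding continuous_embedding_def by blast
qed

section \<open>Compactness\<close>

text \<open>
  Differences of members of the sequence are again uniformly \<open>besov_bounded\<close>. Given \<open>\<epsilon>\<close>, their
  \<open>L\<^sup>q\<close> smallness follows from uniform smallness of their averages at a single scale \<open>k\<close>, which holds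
  along the subsequence of converging cube means.
\<close>

lemma radial_besov_bounded_Lq_precompact:
  fixes u :: "nat \<Rightarrow> real^'n::finite \<Rightarrow> real"
  assumes N: "CARD('n) \<ge> 2" and s: "0 < s" and p: "1 \<le> p" and pq: "p < q"
    and sp: "s * p < real CARD('n)" and q: "(real CARD('n) / p - s) * (q - p) < s * p"
    and BD: "0 \<le> B" "0 \<le> D" and u: "\<And>n. besov_bounded p s k0 B D (u n)"
    and radial: "\<And>n. AE x in lborel. u n x = g n (norm x)"
  obtains v and r :: "nat \<Rightarrow> nat" where "v \<in> borel_measurable borel" "strict_mono r"
    and "\<And>\<epsilon>. 0 < \<epsilon> \<Longrightarrow>
      \<exists>M. \<forall>n\<ge>M. (\<integral>\<^sup>+x. ennreal (\<bar>u (r n) x - v x\<bar> powr q) \<partial>lborel) \<le> ennreal \<epsilon>"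
proof -
  have meas: "u n \<in> borel_measurable borel"
    and mass: "(\<integral>\<^sup>+x. ennreal (\<bar>u n x\<bar> powr p) \<partial>lborel) \<le> ennreal B" for n
    using u by (auto simp: besov_bounded_def)
  obtain r where r: "strict_mono r" and conv: "\<And>k m. convergent (\<lambda>n. cube_mean k m (u (r n)))"
    by (rule cube_means_convergent_subsequence[where u = u, OF p meas BD(1) mass]) blast
  define B' D' where "B' = 2 powr p * (B + B)" and "D' = 2 powr p * (D + D)"
  have BD': "0 \<le> B'" "0 \<le> D'" using BD by (auto simp: B'_def D'_def)
  have Cauchy: "\<exists>M. \<forall>m\<ge>M. \<forall>n\<ge>M.
      (\<integral>\<^sup>+x. ennreal (\<bar>u (r m) x - u (r n) x\<bar> powr q) \<partial>lborel) \<le> ennreal \<epsilon>" if \<epsilon>: "0 < \<epsilon>" for \<epsilon>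
  proof -
    obtain k \<delta> where \<delta>: "0 < \<delta>"
      and small: "\<And>w :: real^'n \<Rightarrow> real. besov_bounded p s k0 B' D' w \<Longrightarrow>
        \<forall>x. \<bar>dyadic_average k w x\<bar> \<le> \<delta> \<Longrightarrow>
        (\<integral>\<^sup>+x. ennreal (\<bar>w x\<bar> powr q) \<partial>lborel) \<le> ennreal \<epsilon>"
      by (rule besov_Lq_small_if_averages_small[where ?k0.0 = k0, OF s p pq sp q BD' \<epsilon>]) blast
    obtain M where M: "\<And>n n' x. M \<le> n \<Longrightarrow> M \<le> n' \<Longrightarrow>
        \<bar>dyadic_average k (u (r n)) x - dyadic_average k (u (r n')) x\<bar> \<le> \<delta>"
      by (rule radial_dyadic_averages_uniformly_Cauchy[where u = "\<lambda>n. u (r n)" and g = "\<lambda>n. g (r n)",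
            OF N p meas radial BD(1) mass conv \<delta>]) blast
    have "(\<integral>\<^sup>+x. ennreal (\<bar>u (r m) x - u (r n) x\<bar> powr q) \<partial>lborel) \<le> ennreal \<epsilon>"
      if "M \<le> m" "M \<le> n" for m n
    proof (rule small)
      show "besov_bounded p s k0 B' D' (\<lambda>x. u (r m) x - u (r n) x)"
        unfolding B'_def D'_def by (rule besov_bounded_diff[OF p BD u u])
      show "\<forall>x. \<bar>dyadic_average k (\<lambda>x. u (r m) x - u (r n) x) x\<bar> \<le> \<delta>"
        unfolding dyadic_average_diff[OF p u u] using M[OF that] by (rule allI)
    qed
    then show ?thesis by blast
  qed
  have q0: "0 < q" using p pq by simp
  have meas': "u (r n) \<in> borel_measurable lborel" for n using meas by simp
  obtain v where v: "v \<in> borel_measurable lborel" and lim: "\<And>\<epsilon>. 0 < \<epsilon> \<Longrightarrow>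
      \<exists>M. \<forall>n\<ge>M. (\<integral>\<^sup>+x. ennreal (\<bar>u (r n) x - v x\<bar> powr q) \<partial>lborel) \<le> ennreal \<epsilon>"
    using Lq_complete[where f = "\<lambda>n. u (r n)", OF q0 meas' Cauchy] by blast
  from v have "v \<in> borel_measurable borel" by simp
  then show thesis using r lim by (rule that)
qed

theorem theorem4p3:
  fixes s p q :: real
  assumes "CARD('n::finite) \<ge> 2"
    and "1 < p"
    and "0 < s" and "s < 1"
    and "s * p < real CARD('n)"
    and "p < q" and "q < critical_exponent CARD('n) s p"
  shows "compact_embedding
           (W_log_rad s p :: (real^'n \<Rightarrow> real) set) (W_log_norm s p)
           (Lp q) (Lp_norm q)"
proof -
  have p: "1 \<le> p" and q0: "0 < q" using assms by auto
  \<comment> \<open>Subcriticality of \<open>q\<close>, rewritten as the condition on the ratio of the geometric series.\<close>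
  have "q * (real CARD('n) - s * p) < real CARD('n) * p"
    using assms by (simp add: critical_exponent_def field_simps)
  moreover have "((real CARD('n) / p - s) * (q - p)) * p
      = q * (real CARD('n) - s * p) - real CARD('n) * p + (s * p) * p"
    using p by (simp add: field_simps)
  ultimately have "((real CARD('n) / p - s) * (q - p)) * p < (s * p) * p"
    by linarith
  then have q: "(real CARD('n) / p - s) * (q - p) < s * p"
    using p by (simp only: mult_less_cancel_right)
  have "continuous_embedding (W_log s p :: (real^'n \<Rightarrow> real) set) (W_log_norm s p) (Lp q) (Lp_norm q)"
    by (rule W_log_continuous_embedding_Lq) (use assms p q in auto)
  then have cont: "continuous_embedding (W_log_rad s p :: (real^'n \<Rightarrow> real) set) (W_log_norm s p) (Lp q) (Lp_norm q)"
    unfolding continuous_embedding_def W_log_rad_def by blast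
  obtain K :: real and k0 :: nat where K: "0 < K"
    and approx: "\<And>(u :: real^'n \<Rightarrow> real) k. u \<in> borel_measurable borel \<Longrightarrow>
      (\<integral>\<^sup>+x. ennreal (\<bar>u x\<bar> powr p) \<partial>lborel) < \<infinity> \<Longrightarrow> k0 \<le> k \<Longrightarrow>
      (\<integral>\<^sup>+x. ennreal (\<bar>u x - dyadic_average k u x\<bar> powr p) \<partial>lborel)
        \<le> ennreal (K * (2 powr - (s * p)) ^ k) * log_energy s p u"
    by (rule dyadic_approximation_le_log_energy[OF assms(3,4) p]) blast
  have "\<exists>v\<in>Lp q. \<exists>r :: nat \<Rightarrow> nat. strict_mono r \<and>
      (\<lambda>k. Lp_norm q (\<lambda>x. u (r k) x - v x)) \<longlonglongrightarrow> 0"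
    if u: "\<And>k. u k \<in> W_log_rad s p" and b: "\<And>k. W_log_norm s p (u k) \<le> b"
    for u :: "nat \<Rightarrow> real^'n \<Rightarrow> real" and b
  proof -
    have uW: "u k \<in> W_log s p" for k
      using u by (simp add: W_log_rad_def)
    have uq: "u k \<in> Lp q" for k
      using cont u by (auto simp: continuous_embedding_def)
    then have meas: "u k \<in> borel_measurable lebesgue" for k
      by (auto simp: Lp_def)
    have "\<exists>u'. (AE x in lborel. u k x = u' x) \<and> besov_bounded p s k0 (b powr p) (K * b powr p) u'" for k
      by (rule besov_bounded_representative[OF p uW[of k] b[of k] K approx]) blast+
    then obtain u' where eq: "\<And>k. AE x in lborel. u k x = u' k x"
      and u': "\<And>k. besov_bounded p s k0 (b powr p) (K * b powr p) (u' k)"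
      by metis
    have "\<exists>g. AE x in lborel. u' k x = g (norm x)" for k
    proof -
      obtain g where "AE x in lebesgue. u k x = g (norm x)"
        using u by (auto simp: W_log_rad_def radially_symmetric_def)
      then have "AE x in lborel. u k x = g (norm x)"
        by (simp add: AE_completion_iff)
      with eq[of k] have "AE x in lborel. u' k x = g (norm x)"
        by eventually_elim simp
      then show ?thesis by blast
    qed
    then obtain g where g: "\<And>k. AE x in lborel. u' k x = g k (norm x)"
      by metis
    have BD: "0 \<le> b powr p" "0 \<le> K * b powr p" using K by auto
    obtain v and r :: "nat \<Rightarrow> nat" where v: "v \<in> borel_measurable borel" and r: "strict_mono r"
      and lim: "\<And>\<epsilon>. 0 < \<epsilon> \<Longrightarrow>
        \<exists>M. \<forall>n\<ge>M. (\<integral>\<^sup>+x. ennreal (\<bar>u' (r n) x - v x\<bar> powr q) \<partial>lborel) \<le> ennreal \<epsilon>"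
      by (rule radial_besov_bounded_Lq_precompact[where u = u' and g = g,
            OF assms(1,3) p assms(6,5) q BD u' g]) blast
    have [measurable]: "v \<in> borel_measurable borel" "u' k \<in> borel_measurable borel" for k
      using v u' by (auto simp: besov_bounded_def)
    have v_leb: "v \<in> borel_measurable lebesgue"
      using v by (intro measurable_completion) simp
    have diff_eq: "AE x in lborel. u (r n) x - v x = u' (r n) x - v x" for n
      using eq[of "r n"] by eventually_elim simp
    have small: "\<exists>M. \<forall>n\<ge>M. (\<lambda>x. u (r n) x - v x) \<in> Lp q \<and>
        Lp_norm q (\<lambda>x. u (r n) x - v x) \<le> \<epsilon> powr (1 / q)" if \<epsilon>: "0 < \<epsilon>" for \<epsilon>
    proof -
      obtain M where M: "\<And>n. M \<le> n \<Longrightarrow>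
          (\<integral>\<^sup>+x. ennreal (\<bar>u' (r n) x - v x\<bar> powr q) \<partial>lborel) \<le> ennreal \<epsilon>"
        using lim[OF \<epsilon>] by blast
      have "(\<lambda>x. u (r n) x - v x) \<in> borel_measurable lebesgue" for n
        using meas v_leb by (intro borel_measurable_diff)
      then show ?thesis
        using Lp_if_nn_integral_le[OF q0 _ diff_eq _ M] \<epsilon> by (metis less_imp_le)
    qed
    \<comment> \<open>The limit is \<open>u' (r n) - (u' (r n) - v)\<close> for any \<open>n\<close> at which the difference is in \<open>L\<^sup>q\<close>.\<close>
    have "v \<in> Lp q"
    proof -
      obtain n where n: "(\<integral>\<^sup>+x. ennreal (\<bar>u' (r n) x - v x\<bar> powr q) \<partial>lborel) \<le> ennreal 1"
        using lim[of 1] by auto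
      have "integrable lebesgue (\<lambda>x. \<bar>u (r n) x\<bar> powr q)"
        using uq by (simp add: Lp_def)
      then have "(\<integral>\<^sup>+x. ennreal (\<bar>u (r n) x\<bar> powr q) \<partial>lebesgue) < \<infinity>"
        by (simp add: nn_integral_eq_integral)
      moreover have "(\<integral>\<^sup>+x. ennreal (\<bar>u (r n) x\<bar> powr q) \<partial>lebesgue)
          = (\<integral>\<^sup>+x. ennreal (\<bar>u' (r n) x\<bar> powr q) \<partial>lborel)"
        unfolding nn_integral_completion using eq[of "r n"] by (intro nn_integral_cong_AE) auto
      ultimately obtain c where c: "0 \<le> c" "(\<integral>\<^sup>+x. ennreal (\<bar>u' (r n) x\<bar> powr q) \<partial>lborel) = ennreal c"
        by (metis ennreal_cases infinity_ennreal_def less_irrefl)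
      have "(\<integral>\<^sup>+x. ennreal (\<bar>u' (r n) x - (u' (r n) x - v x)\<bar> powr q) \<partial>lborel)
          \<le> ennreal (2 powr q * (c + 1))"
        by (rule nn_integral_powr_diff_le) (use q0 c n in auto)
      then have "(\<integral>\<^sup>+x. ennreal (\<bar>v x\<bar> powr q) \<partial>lborel) \<le> ennreal (2 powr q * (c + 1))"
        by simp
      then show ?thesis
        using c by (intro Lp_if_nn_integral_le(1)[OF q0 v_leb, of v]) auto
    qed
    moreover have "(\<lambda>n. Lp_norm q (\<lambda>x. u (r n) x - v x)) \<longlonglongrightarrow> 0"
    proof (rule LIMSEQ_I)
      fix e :: real assume e: "0 < e"
      then have "0 < (e / 2) powr q" by simp
      from small[OF this] obtain M where "\<And>n. M \<le> n \<Longrightarrow>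
          Lp_norm q (\<lambda>x. u (r n) x - v x) \<le> ((e / 2) powr q) powr (1 / q)"
        by blast
      moreover have "((e / 2) powr q) powr (1 / q) < e"
        using e q0 by (simp add: powr_powr)
      ultimately show "\<exists>M. \<forall>n\<ge>M. norm (Lp_norm q (\<lambda>x. u (r n) x - v x) - 0) < e"
        by (intro exI[of _ M]) (force simp: Lp_norm_def)
    qed
    ultimately show ?thesis using r by blast
  qed
  then show ?thesis
    unfolding compact_embedding_def using cont by blast
qed

end
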